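(* Let $M,K,(D_{ij})_{i,j=1}^q$ be as in the context, with the eigenvalues of $P=M^{-1/2}KM^{-1/2}$ pairwise distinct. Then the array $$M\ddot x_i+Kx_i+\sum_{j=1}^q D_{ij}(\dot x_i-\dot x_j)=0,\qquad i=1,\dots,q,$$ synchronizes if and only if $\lambda_2(G_{kk})>0$ for all $k=1,\dots,n$.
   Context: Let $n\ge 1$ and $q\ge 2$ be integers; $\otimes$ denotes the Kronecker product. $M,K\in\mathbb{R}^{n\times n}$ are symmetric positive definite. For $i,j\in\{1,\dots,q\}$ the matrices $D_{ij}\in\mathbb{R}^{n\times n}$ are symmetric positive semidefinite with $D_{ij}=D_{ji}$ and $D_{ii}=0$. The unknowns are $x_i(t)\in\mathbb{R}^n$. Put $P:=M^{-1/2}KM^{-1/2}$; its eigenvalues $\sigma_1,\dots,\sigma_n>0$ are assumed pairwise distinct, with corresponding real unit eigenvectors $v_1,\dots,v_n\in\mathbb{R}^n$. The array synchronizes if $\|x_i(t)-x_j(t)\|\to 0$ as $t\to\infty$ for all $i,j$ and for every solution (all initial conditions). Let $L_{\mathrm d}\in\mathbb{R}^{qn\times qn}$ be the block matrix whose $(i,i)$ block is $\sum_j M^{-1/2}D_{ij}M^{-1/2}$ and whose $(i,j)$ block, $i\neq j$, is $-M^{-1/2}D_{ij}M^{-1/2}$. For $k=1,\dots,n$ let $G_{kk}=[I_q\otimes v_k^T]L_{\mathrm d}[I_q\otimes v_k]\in\mathbb{R}^{q\times q}$, a real symmetric positive semidefinite matrix; $\lambda_2(G_{kk})$ denotes its second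 smallest eigenvalue, counted with multiplicity. *)

theory Defs
  imports "HOL-Analysis.Analysis" "HOL-Computational_Algebra.Computational_Algebra"
begin

definition sym_psd :: "real^'n^'n \<Rightarrow> bool" where
  "sym_psd A \<longleftrightarrow> transpose A = A \<and> (\<forall>x. 0 \<le> x \<bullet> (A *v x))"

definition sym_pd :: "real^'n^'n \<Rightarrow> bool" where
  "sym_pd A \<longleftrightarrow> transpose A = A \<and> (\<forall>x. x \<noteq> 0 \<longrightarrow> 0 < x \<bullet> (A *v x))"

definition psd_sqrt :: "real^'n^'n \<Rightarrow> real^'n^'n" where
  "psd_sqrt A = (THE S. sym_psd S \<and> S ** S = A)"

(* The power A^(-1/2). *)
definition inv_sqrt :: "real^'n^'n \<Rightarrow> real^'n^'n" where
  "inv_sqrt A = matrix_inv (psd_sqrt A)"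

definition kronecker :: "real^'b^'a \<Rightarrow> real^'d^'c \<Rightarrow> real^('b \<times> 'd)^('a \<times> 'c)" where
  "kronecker A B = (\<chi> r s. A $ fst r $ fst s * B $ snd r $ snd s)"

definition charpoly :: "real^'n^'n \<Rightarrow> real poly" where
  "charpoly A = det (\<chi> i j. (if i = j then [:0, 1:] else 0) - [:A $ i $ j:])"

(* The real eigenvalues in increasing order, repeated according to algebraic multiplicity;
   for a symmetric matrix the list has length CARD('n). *)
definition eigenvalue_list :: "real^'n^'n \<Rightarrow> real list" where
  "eigenvalue_list A = sorted_list_of_multiset (proots (charpoly A))"

(* Meaningful for symmetric matrices of size at least 2; list indices start at 0. *)
definition lambda2 :: "real^'n^'n \<Rightarrow> real" where
  "lambda2 A = eigenvalue_list A ! 1"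

definition P_mat :: "real^'n^'n \<Rightarrow> real^'n^'n \<Rightarrow> real^'n^'n" where
  "P_mat M K = inv_sqrt M ** K ** inv_sqrt M"

(* The index (i, a) is entry a of block i, which matches the index order of kronecker. *)
definition L_d :: "real^'n^'n \<Rightarrow> ('q::finite \<Rightarrow> 'q \<Rightarrow> real^'n^'n) \<Rightarrow> real^('q \<times> 'n)^('q \<times> 'n)" where
  "L_d M D = (\<chi> r s.
     (if fst r = fst s
      then \<Sum>j\<in>UNIV. inv_sqrt M ** D (fst r) j ** inv_sqrt M
      else - (inv_sqrt M ** D (fst r) (fst s) ** inv_sqrt M)) $ snd r $ snd s)"

(* [I_q \<otimes> v^T] L_d [I_q \<otimes> v].  Since v is an n-by-1 matrix, the product is indexed by 'q \<times> 1;
   it is reindexed by 'q. *)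
definition G_mat :: "real^'n^'n \<Rightarrow> ('q::finite \<Rightarrow> 'q \<Rightarrow> real^'n^'n) \<Rightarrow> real^'n \<Rightarrow> real^'q^'q" where
  "G_mat M D v =
     (let N = kronecker (mat 1) (rowvector v :: real^'n^1) ** L_d M D
              ** kronecker (mat 1) (columnvector v :: real^1^'n)
      in (\<chi> i j. N $ (i, 1) $ (j, 1)))"

(* Classical solutions on [0, \<infinity>), with one-sided derivatives at 0; x' and x'' are the first and
   second derivatives of x. *)
definition array_solution ::
  "real^'n^'n \<Rightarrow> real^'n^'n \<Rightarrow> ('q::finite \<Rightarrow> 'q \<Rightarrow> real^'n^'n) \<Rightarrow> ('q \<Rightarrow> real \<Rightarrow> real^'n) \<Rightarrow> bool" where
  "array_solution M K D x \<longleftrightarrow> (\<exists>x' x''. \<forall>i. \<forall>t\<ge>0.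
     (x i has_vector_derivative x' i t) (at t within {0..}) \<and>
     (x' i has_vector_derivative x'' i t) (at t within {0..}) \<and>
     M *v x'' i t + K *v x i t + (\<Sum>j\<in>UNIV. D i j *v (x' i t - x' j t)) = 0)"

definition synchronizes ::
  "real^'n^'n \<Rightarrow> real^'n^'n \<Rightarrow> ('q::finite \<Rightarrow> 'q \<Rightarrow> real^'n^'n) \<Rightarrow> bool" where
  "synchronizes M K D \<longleftrightarrow> (\<forall>x. array_solution M K D x \<longrightarrow>
     (\<forall>i j. ((\<lambda>t. norm (x i t - x j t)) \<longlongrightarrow> 0) at_top))"

end

theory Submission
  imports Defs
begin

text \<open>
  Write \<open>R\<close> for the inverse square root of \<open>M\<close> and \<open>b k = R v k\<close>. Because the eigenvalues of
  \<open>P = R K R\<close> are distinct, the vectors \<open>v k\<close> form an orthonormal basis, so the \<open>b k\<close> are the normal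
  modes of the undamped oscillator: \<open>K b k = \<sigma> k M b k\<close>, and they are orthonormal for the inner
  product given by \<open>M\<close> (\<open>normal_modes_of_P_mat\<close>). The matrix \<open>G\<^sub>k\<^sub>k\<close> is the Laplacian of the graph on the
  oscillators with weights \<open>b k \<bullet> D i j (b k) \<ge> 0\<close>, and its second smallest eigenvalue is positive iff
  that graph is connected. In the form used here: the only functions \<open>f\<close> of the oscillators with
  \<open>(b k \<bullet> D i j (b k)) (f i - f j) = 0\<close> for all \<open>i, j\<close> are the constants (\<open>laplacian_lambda2_pos_iff\<close>).
  Relating this to the characteristic polynomial requires the spectral theorem for real symmetric
  matrices, which is proved by maximising the Rayleigh quotient on invariant subspaces
  (\<open>symmetric_matrix_eigenbasis\<close>); it also shows that the square root of \<open>M\<close> exists.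

  If some graph is disconnected, let \<open>f\<close> be a nonconstant such function. The standing wave
  \<open>x\<^sub>i(t) = f i cos(\<surd>\<sigma>\<^sub>k t) b k\<close> never feels the dampers, since \<open>D i j (b k) = 0\<close> whenever \<open>f i \<noteq> f j\<close>.
  It is a solution that does not synchronize (\<open>standing_wave_solution\<close>).

  If all graphs are connected, pass to modal coordinates. The energy is nonincreasing and the
  stiffness is positive, so every solution is bounded, and so are all its derivatives. A convergent
  function with bounded second derivative has derivative tending to zero
  (\<open>derivative_tendsto_0\<close>). Applied to the energy this makes the dissipated power tend to zero, hence
  also each damping force \<open>F\<^sub>i\<^sub>j (u\<^sub>i - u\<^sub>j)\<close>, where \<open>u\<^sub>i\<close> are the velocities and \<open>F\<^sub>i\<^sub>j\<close> is \<open>D i j\<close> in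
  modal coordinates. The same principle says that a linear output of the state that tends to zero
  has a derivative tending to zero (\<open>linear_flow_output_tendsto_0\<close>). Asymptotically two
  derivatives multiply the \<open>k\<close>-th modal velocity by \<open>-\<sigma> k\<close>, so \<open>F\<^sub>i\<^sub>j p(\<Sigma>) (u\<^sub>i - u\<^sub>j)\<close> tends to zero for
  polynomials \<open>p\<close>, where \<open>\<Sigma>\<close> is the diagonal matrix of the \<open>\<sigma> k\<close>. The \<open>\<sigma> k\<close> being distinct, a
  product of factors \<open>\<sigma> - \<sigma> l\<close> isolates a single mode (\<open>modal_force_tendsto_0\<close>): the velocities of any
  two oscillators adjacent in the \<open>k\<close>-th graph approach each other in mode \<open>k\<close>. By connectedness all
  velocities do, then by the output principle all accelerations, and finally, through the equation
  of motion, all positions (\<open>array_synchronizes\<close>). This is the invariance principle with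
  derivatives of outputs in place of limit sets.
\<close>

section \<open>Symmetric matrices and their eigenbases\<close>

text \<open>The quadratic polynomial \<open>t \<mapsto> (x + t y) \<bullet> f (x + t y)\<close> is nonnegative, so its discriminant is
  not positive. The inequality says most about degenerate forms: a null vector \<open>x\<close> is then
  orthogonal to \<open>f y\<close> for all \<open>y\<close> in the subspace.\<close>

lemma psd_cauchy_schwarz:
  fixes f :: "'a::real_inner \<Rightarrow> 'a"
  assumes "linear f" and sym: "\<And>x y. f x \<bullet> y = x \<bullet> f y"
    and S: "subspace S" and psd: "\<And>x. x \<in> S \<Longrightarrow> 0 \<le> x \<bullet> f x"
    and x: "x \<in> S" and y: "y \<in> S"
  shows "(x \<bullet> f y)\<^sup>2 \<le> (x \<bullet> f x) * (y \<bullet> f y)"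
proof -
  interpret f: linear f by fact
  define a b c where "a = x \<bullet> f x" and "b = x \<bullet> f y" and "c = y \<bullet> f y"
  have b': "y \<bullet> f x = x \<bullet> f y" using sym[of x y] by (simp add: inner_commute)
  have quad: "0 \<le> a + 2 * b * t + c * t\<^sup>2" for t
  proof -
    have "0 \<le> (x + t *\<^sub>R y) \<bullet> f (x + t *\<^sub>R y)"
      by (intro psd subspace_add subspace_scale S x y)
    also have "\<dots> = a + 2 * b * t + c * t\<^sup>2"
      unfolding a_def b_def c_def f.add f.scale inner_add_left inner_add_right inner_scaleR_left
        inner_scaleR_right b' power2_eq_square by algebra
    finally show ?thesis .
  qed
  have "c \<ge> 0" using psd[OF y] by (simp add: c_def)
  have "b\<^sup>2 \<le> a * c"
  proof (cases "c = 0")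
    case True
    have "b = 0"
    proof (rule ccontr)
      assume "b \<noteq> 0"
      then have "a + 2 * b * (- (a + 1) / (2 * b)) = -1" by (simp add: field_simps)
      with quad[of "- (a + 1) / (2 * b)"] True show False by simp
    qed
    then show ?thesis using True by simp
  next
    case False
    then have "c > 0" using \<open>c \<ge> 0\<close> by simp
    have "a + 2 * b * (- b / c) + c * (- b / c)\<^sup>2 = (a * c - b\<^sup>2) / c"
      using False by (simp add: power2_eq_square diff_divide_distrib)
    then have "0 \<le> (a * c - b\<^sup>2) / c" using quad[of "- b / c"] by simp
    then show ?thesis using \<open>c > 0\<close> by (simp add: zero_le_divide_iff)
  qed
  then show ?thesis by (simp add: a_def b_def c_def)
qed

text \<open>Let \<open>v\<close> maximise \<open>x \<bullet> f x\<close> on the unit sphere of \<open>S\<close>, with maximum \<open>c\<close>. Then \<open>g = c - f\<close> is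
  positive semidefinite on \<open>S\<close> and its form vanishes at \<open>v\<close>, so Cauchy-Schwarz gives
  \<open>w \<bullet> g v = 0\<close> for every \<open>w\<close> in \<open>S\<close>, in particular for \<open>w = g v\<close>.\<close>

lemma symmetric_invariant_subspace_eigenvector:
  fixes f :: "'a::euclidean_space \<Rightarrow> 'a"
  assumes "linear f" and sym: "\<And>x y. f x \<bullet> y = x \<bullet> f y"
    and S: "subspace S" and inv: "\<And>x. x \<in> S \<Longrightarrow> f x \<in> S" and "S \<noteq> {0}"
  obtains v c where "v \<in> S" "norm v = 1" "f v = c *\<^sub>R v"
proof -
  interpret f: linear f by fact
  let ?T = "sphere 0 1 \<inter> S"
  obtain s where s: "s \<in> S" "s \<noteq> 0" using \<open>S \<noteq> {0}\<close> subspace_0[OF S] by blast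
  then have "(1 / norm s) *\<^sub>R s \<in> ?T" by (simp add: subspace_scale[OF S])
  then have "?T \<noteq> {}" by blast
  moreover have "compact ?T" by (simp add: closed_subspace[OF S] compact_Int_closed)
  moreover have "continuous_on ?T (\<lambda>x. x \<bullet> f x)"
    using linear_continuous_on[OF linear_conv_bounded_linear[THEN iffD1, OF \<open>linear f\<close>]]
    by (intro continuous_on_inner continuous_on_id)
  ultimately obtain v where v: "v \<in> ?T" and max: "\<And>x. x \<in> ?T \<Longrightarrow> x \<bullet> f x \<le> v \<bullet> f v"
    using continuous_attains_sup by metis
  define c where "c = v \<bullet> f v"
  define g where "g x = c *\<^sub>R x - f x" for x
  have v1: "v \<in> S" "norm v = 1" using v by auto
  have "linear g" unfolding g_def by (intro linearI) (simp_all add: f.add f.scale algebra_simps)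
  have gsym: "g x \<bullet> y = x \<bullet> g y" for x y by (simp add: g_def inner_diff sym)
  have gpsd: "0 \<le> x \<bullet> g x" if "x \<in> S" for x
  proof (cases "x = 0")
    case False
    let ?y = "(1 / norm x) *\<^sub>R x"
    have "?y \<in> ?T" using that False by (simp add: subspace_scale[OF S])
    from max[OF this] have "(x \<bullet> f x) / (norm x)\<^sup>2 \<le> c"
      unfolding c_def[symmetric] f.scale inner_scaleR_left inner_scaleR_right
      by (simp add: power2_eq_square)
    then have "x \<bullet> f x \<le> c * (norm x)\<^sup>2"
      using False pos_divide_le_eq[of "(norm x)\<^sup>2"] by simp
    then show ?thesis by (simp add: g_def inner_diff_right power2_norm_eq_inner)
  qed simp
  have "v \<bullet> v = 1" using v1 by (simp add: norm_eq_1)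
  then have gv: "v \<bullet> g v = 0" by (simp add: g_def inner_diff c_def)
  have "g v \<in> S" unfolding g_def by (intro subspace_diff subspace_scale S v1 inv)
  from psd_cauchy_schwarz[OF \<open>linear g\<close> gsym S gpsd this v1(1)] gv
  have "(g v \<bullet> g v)\<^sup>2 \<le> 0" by simp
  then have "g v = 0" by simp
  then have "f v = c *\<^sub>R v" by (simp add: g_def)
  with v1 show thesis using that by blast
qed

text \<open>Induction on the dimension: symmetry makes the orthogonal complement of an eigenvector within
  \<open>S\<close> invariant again.\<close>

lemma symmetric_invariant_subspace_eigenbasis:
  fixes f :: "'a::euclidean_space \<Rightarrow> 'a"
  assumes "linear f" and sym: "\<And>x y. f x \<bullet> y = x \<bullet> f y"
    and "subspace S" and "\<And>x. x \<in> S \<Longrightarrow> f x \<in> S"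
  shows "\<exists>B. pairwise orthogonal B \<and> span B = S \<and> (\<forall>b\<in>B. norm b = 1 \<and> (\<exists>c. f b = c *\<^sub>R b))"
  using assms(3,4)
proof (induction "dim S" arbitrary: S rule: less_induct)
  case less
  note S = less.prems(1)
  show ?case
  proof (cases "S = {0}")
    case True
    then show ?thesis by (intro exI[of _ "{}"]) auto
  next
    case False
    obtain v c where v: "v \<in> S" "norm v = 1" "f v = c *\<^sub>R v"
      using symmetric_invariant_subspace_eigenvector[OF assms(1) sym less.prems False] .
    have vv: "v \<bullet> v = 1" using v by (simp add: norm_eq_1)
    define T where "T = {y \<in> S. v \<bullet> y = 0}"
    have T: "subspace T" using S
      by (auto simp: T_def subspace_def inner_add inner_scaleR_right)
    have "v \<notin> T" using vv by (simp add: T_def)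
    then have "T \<subset> S" using v(1) unfolding T_def by blast
    then have "dim T < dim S" using dim_psubset S T by (metis span_eq_iff)
    moreover have "f x \<in> T" if "x \<in> T" for x
    proof -
      have "v \<bullet> f x = f v \<bullet> x" by (simp add: sym)
      then show ?thesis using that v less.prems(2) by (simp add: T_def)
    qed
    ultimately obtain B where B: "pairwise orthogonal B" "span B = T"
      "\<forall>b\<in>B. norm b = 1 \<and> (\<exists>c. f b = c *\<^sub>R b)"
      using less.hyps[of T] T by blast
    have BT: "B \<subseteq> T" using B(2) span_superset by blast
    have "span (insert v B) = S"
    proof
      show "span (insert v B) \<subseteq> S"
        using v BT S by (intro span_minimal) (auto simp: T_def)
      show "S \<subseteq> span (insert v B)"
      proof
        fix x assume "x \<in> S"
        have "x - (v \<bullet> x) *\<^sub>R v \<in> T"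
          using \<open>x \<in> S\<close> v vv by (auto simp: T_def inner_diff intro!: subspace_diff subspace_scale S)
        then show "x \<in> span (insert v B)" using B(2) span_breakdown_eq by blast
      qed
    qed
    moreover have "pairwise orthogonal (insert v B)"
      using B(1) BT by (auto simp: pairwise_insert T_def orthogonal_def inner_commute)
    ultimately show ?thesis using B(3) v by (intro exI[of _ "insert v B"]) auto
  qed
qed

text \<open>Families rather than sets of vectors, so that eigenvectors and eigenvalues share the index type
  of the matrix; a family indexed by the coordinates is then automatically a basis.\<close>

definition orthonormal_family :: "('n \<Rightarrow> 'a::real_inner) \<Rightarrow> bool" where
  "orthonormal_family w \<longleftrightarrow> (\<forall>k l. w k \<bullet> w l = (if k = l then 1 else 0))"

lemma orthonormal_family_inner:
  "orthonormal_family w \<Longrightarrow> w k \<bullet> w l = (if k = l then 1 else 0)"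
  by (simp add: orthonormal_family_def)

lemma orthonormal_family_expand:
  fixes w :: "'n::finite \<Rightarrow> real^'n"
  assumes w: "orthonormal_family w"
  shows "(\<Sum>k\<in>UNIV. (w k \<bullet> x) *\<^sub>R w k) = x"
proof -
  have inj: "inj w"
    by (rule injI) (metis orthonormal_family_inner[OF w] zero_neq_one)
  have orth: "pairwise orthogonal (range w)"
    using orthonormal_family_inner[OF w] by (auto simp: pairwise_def orthogonal_def)
  have norm1: "norm b = 1" if "b \<in> range w" for b
    using that orthonormal_family_inner[OF w] by (auto simp: norm_eq_1)
  have "0 \<notin> range w" using norm1 by fastforce
  then have "independent (range w)" using orth pairwise_orthogonal_independent by blast
  moreover have "card (range w) = CARD('n)" using inj by (simp add: card_image)
  ultimately have "UNIV \<subseteq> span (range w)"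
    by (intro card_ge_dim_independent) (auto simp: dim_UNIV)
  then have "(\<Sum>i\<in>range w. (x \<bullet> i) *\<^sub>R i) = x"
    using orthonormal_basis_expand[OF orth norm1] by auto
  then show ?thesis
    by (simp add: sum.reindex[OF inj] inner_commute)
qed

lemma symmetric_matrix_inner:
  fixes A :: "real^'n^'n"
  assumes "transpose A = A"
  shows "(A *v x) \<bullet> y = x \<bullet> (A *v y)"
  by (metis assms dot_lmul_matrix vector_transpose_matrix)

text \<open>The spectral theorem, with the eigenbasis reindexed by the coordinates: there are as many basis
  vectors as coordinates.\<close>

theorem symmetric_matrix_eigenbasis:
  fixes A :: "real^'n^'n"
  assumes "transpose A = A"
  obtains w :: "'n \<Rightarrow> real^'n" and d where
    "orthonormal_family w" "\<And>k. A *v w k = d k *\<^sub>R w k"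
proof -
  obtain B where B: "pairwise orthogonal B" "span B = UNIV"
      "\<And>b. b \<in> B \<Longrightarrow> norm b = 1" "\<And>b. b \<in> B \<Longrightarrow> (\<exists>c. A *v b = c *\<^sub>R b)"
    using symmetric_invariant_subspace_eigenbasis[of "(*v) A" UNIV]
      symmetric_matrix_inner[OF assms] by auto
  have "0 \<notin> B" using B(3) by fastforce
  then have ind: "independent B" using B(1) pairwise_orthogonal_independent by blast
  then have "card B = dim (UNIV :: (real^'n) set)" using B(2) by (metis dim_eq_card dim_span)
  then have "card B = card (UNIV :: 'n set)" by (simp add: dim_UNIV)
  then obtain w where w: "bij_betw w (UNIV :: 'n set) B"
    using finite_same_card_bij[OF finite_class.finite_UNIV independent_imp_finite[OF ind]] by metis
  then have wB: "w k \<in> B" for k by (auto simp: bij_betw_def)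
  have "orthonormal_family w"
    unfolding orthonormal_family_def
  proof (intro allI)
    fix k l
    show "w k \<bullet> w l = (if k = l then 1 else 0)"
    proof (cases "k = l")
      case True
      then show ?thesis using B(3)[OF wB[of k]] by (simp add: norm_eq_1)
    next
      case False
      then have "w k \<noteq> w l" using w by (auto simp: bij_betw_def inj_def)
      then show ?thesis using B(1) wB False by (auto simp: pairwise_def orthogonal_def)
    qed
  qed
  moreover obtain d where "\<And>k. A *v w k = d k *\<^sub>R w k" using B(4)[OF wB] by metis
  ultimately show thesis using that by blast
qed

lemma matrix_eqI_orthonormal:
  fixes w :: "'n::finite \<Rightarrow> real^'n" and A B :: "real^'n^'m"
  assumes w: "orthonormal_family w" and eq: "\<And>k. A *v w k = B *v w k"
  shows "A = B"
proof -
  have "A *v x = B *v x" for x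
  proof -
    have "A *v (\<Sum>k\<in>UNIV. (w k \<bullet> x) *\<^sub>R w k) = B *v (\<Sum>k\<in>UNIV. (w k \<bullet> x) *\<^sub>R w k)"
      by (simp add: linear_sum[OF matrix_vector_mul_linear] matrix_vector_mult_scaleR eq)
    then show ?thesis by (simp add: orthonormal_family_expand[OF w])
  qed
  then show ?thesis by (simp add: matrix_eq)
qed

lemma sym_psd_symmetric: "sym_psd A \<Longrightarrow> (A *v x) \<bullet> y = x \<bullet> (A *v y)"
  by (simp add: sym_psd_def symmetric_matrix_inner)

lemma sym_psd_nonneg: "sym_psd A \<Longrightarrow> 0 \<le> x \<bullet> (A *v x)"
  by (simp add: sym_psd_def)

lemma sym_pd_imp_psd: "sym_pd A \<Longrightarrow> sym_psd A"
  unfolding sym_pd_def sym_psd_def by (metis inner_zero_left order_less_imp_le order_refl)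

text \<open>Apply Cauchy-Schwarz for the form of \<open>F\<close> to the pair \<open>F x\<close>, \<open>x\<close>. The bound turns statements
  about the dissipated power \<open>x \<bullet> F x\<close> into statements about the damping force \<open>F x\<close>.\<close>

lemma sym_psd_norm_le_quadratic:
  fixes F :: "real^'n^'n"
  assumes F: "sym_psd F"
  obtains c where "\<And>x. (norm (F *v x))\<^sup>2 \<le> c * (x \<bullet> (F *v x))"
proof -
  obtain c where c: "\<And>x. norm (F *v x) \<le> c * norm x"
    using linear_bounded[OF matrix_vector_mul_linear] by blast
  have "(norm (F *v x))\<^sup>2 \<le> c * (x \<bullet> (F *v x))" for x
  proof (cases "F *v x = 0")
    case False
    let ?z = "F *v x"
    have psd: "0 \<le> y \<bullet> (F *v y)" for y using F by (simp add: sym_psd_def)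
    have sym: "(F *v x) \<bullet> y = x \<bullet> (F *v y)" for x y
      using F by (simp add: sym_psd_def symmetric_matrix_inner)
    have "((norm ?z)\<^sup>2)\<^sup>2 = (?z \<bullet> (F *v x))\<^sup>2" by (simp add: power2_norm_eq_inner)
    also have "\<dots> \<le> (?z \<bullet> (F *v ?z)) * (x \<bullet> (F *v x))"
      by (rule psd_cauchy_schwarz[where S=UNIV]) (auto simp: psd sym)
    also have "\<dots> \<le> (c * (norm ?z)\<^sup>2) * (x \<bullet> (F *v x))"
    proof (rule mult_right_mono[OF _ psd])
      have "?z \<bullet> (F *v ?z) \<le> norm ?z * norm (F *v ?z)" by (rule norm_cauchy_schwarz)
      also have "\<dots> \<le> norm ?z * (c * norm ?z)" by (intro mult_left_mono c) simp
      finally show "?z \<bullet> (F *v ?z) \<le> c * (norm ?z)\<^sup>2" by (simp add: power2_eq_square mult_ac)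
    qed
    finally have "(norm ?z)\<^sup>2 * (norm ?z)\<^sup>2 \<le> (norm ?z)\<^sup>2 * (c * (x \<bullet> (F *v x)))"
      by (simp add: power2_eq_square mult_ac)
    moreover have "0 < (norm ?z)\<^sup>2" using False by simp
    ultimately show ?thesis by (metis mult_le_cancel_left_pos)
  qed simp
  then show thesis using that by blast
qed

section \<open>The positive semidefinite square root\<close>

lemma psd_eigenvalue_nonneg:
  assumes "sym_psd A" "orthonormal_family w" "A *v w k = d *\<^sub>R w k"
  shows "0 \<le> d"
  using sym_psd_nonneg[OF assms(1), of "w k"] orthonormal_family_inner[OF assms(2), of k k] assms(3)
  by simp

text \<open>This forces a positive semidefinite square root on every eigenvector and is the reason for its
  uniqueness. The residual \<open>z = S x - \<surd>d x\<close> satisfies \<open>S z = - \<surd>d z\<close>, which contradicts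
  semidefiniteness unless \<open>z = 0\<close> or \<open>d = 0\<close>; in the latter case \<open>|S x|\<^sup>2 = x \<bullet> S (S x) = 0\<close>.\<close>

lemma psd_sqrt_eigenvector:
  assumes S: "sym_psd S" and eig: "(S ** S) *v x = d *\<^sub>R x" and "0 \<le> d"
  shows "S *v x = sqrt d *\<^sub>R x"
proof -
  define r z where "r = sqrt d" and "z = S *v x - r *\<^sub>R x"
  have r: "r \<ge> 0" "r * r = d" using \<open>0 \<le> d\<close> by (auto simp: r_def)
  have "S *v z = d *\<^sub>R x - r *\<^sub>R (S *v x)"
    using eig by (simp add: z_def matrix_vector_mult_diff_distrib matrix_vector_mult_scaleR
        matrix_vector_mul_assoc)
  then have Sz: "S *v z = - r *\<^sub>R z"
    by (simp add: z_def scaleR_diff_right r(2))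
  have "z = 0"
  proof (cases "r = 0")
    case True
    then have "S *v (S *v x) = 0" using r(2) eig by (simp add: matrix_vector_mul_assoc)
    moreover have "(S *v x) \<bullet> (S *v x) = x \<bullet> (S *v (S *v x))"
      by (rule sym_psd_symmetric[OF S])
    ultimately show ?thesis using True by (simp add: z_def)
  next
    case False
    then have "r > 0" using r by simp
    have "0 \<le> - r * (z \<bullet> z)" using sym_psd_nonneg[OF S, of z] Sz by simp
    then have "z \<bullet> z \<le> 0" using \<open>r > 0\<close> by (simp add: mult_le_0_iff)
    then show ?thesis using inner_ge_zero[of z] by (metis antisym inner_eq_zero_iff)
  qed
  then show ?thesis by (simp add: z_def r_def)
qed

lemma ex1_psd_sqrt:
  fixes M :: "real^'n^'n"
  assumes M: "sym_psd M"
  shows "\<exists>!S. sym_psd S \<and> S ** S = M"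
proof -
  obtain w :: "'n \<Rightarrow> real^'n" and d where w: "orthonormal_family w"
    and eig: "\<And>k. M *v w k = d k *\<^sub>R w k"
    using symmetric_matrix_eigenbasis M unfolding sym_psd_def by metis
  have d: "d k \<ge> 0" for k using psd_eigenvalue_nonneg[OF M w eig] .
  define S :: "real^'n^'n" where "S = (\<chi> i j. \<Sum>k\<in>UNIV. sqrt (d k) * w k $ i * w k $ j)"
  have Sx: "S *v x = (\<Sum>k\<in>UNIV. (sqrt (d k) * (w k \<bullet> x)) *\<^sub>R w k)" for x
    unfolding vec_eq_iff
  proof
    fix i
    have "(S *v x) $ i = (\<Sum>j\<in>UNIV. \<Sum>k\<in>UNIV. sqrt (d k) * w k $ i * w k $ j * x $ j)"
      by (simp add: S_def matrix_vector_mult_def sum_distrib_right)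
    also have "\<dots> = (\<Sum>k\<in>UNIV. \<Sum>j\<in>UNIV. sqrt (d k) * w k $ i * w k $ j * x $ j)"
      by (rule sum.swap)
    also have "\<dots> = (\<Sum>k\<in>UNIV. (sqrt (d k) * (w k \<bullet> x)) *\<^sub>R w k) $ i"
      by (simp add: inner_vec_def sum_distrib_left sum_distrib_right mult_ac)
    finally show "(S *v x) $ i = (\<Sum>k\<in>UNIV. (sqrt (d k) * (w k \<bullet> x)) *\<^sub>R w k) $ i" .
  qed
  have Sw: "S *v w l = sqrt (d l) *\<^sub>R w l" for l
    unfolding Sx by (simp add: orthonormal_family_inner[OF w] if_distrib if_distribR sum.delta cong: if_cong)
  have "transpose S = S" by (simp add: S_def transpose_def mult_ac)
  moreover have "0 \<le> x \<bullet> (S *v x)" for x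
    unfolding Sx inner_sum_right using d
    by (intro sum_nonneg) (simp add: inner_commute[of x] mult.assoc)
  ultimately have S: "sym_psd S" by (simp add: sym_psd_def)
  moreover have "S ** S = M"
    by (rule matrix_eqI_orthonormal[OF w])
      (simp add: matrix_vector_mul_assoc[symmetric] Sw matrix_vector_mult_scaleR eig d)
  moreover have "T = S" if "sym_psd T \<and> T ** T = M" for T
    using that by (intro matrix_eqI_orthonormal[OF w])
      (simp add: Sw psd_sqrt_eigenvector d eig)
  ultimately show ?thesis by blast
qed

lemma psd_sqrt:
  assumes "sym_psd M"
  shows "sym_psd (psd_sqrt M)" "psd_sqrt M ** psd_sqrt M = M"
  using theI'[OF ex1_psd_sqrt[OF assms]] by (simp_all add: psd_sqrt_def)

lemma inv_sqrt_psd_sqrt: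
  assumes M: "sym_pd M"
  shows "inv_sqrt M ** psd_sqrt M = mat 1" "psd_sqrt M ** inv_sqrt M = mat 1"
proof -
  let ?S = "psd_sqrt M"
  note S = psd_sqrt[OF sym_pd_imp_psd[OF M]]
  have "x = 0" if "?S *v x = 0" for x
  proof -
    have "M *v x = 0" using that S(2) by (metis matrix_vector_mul_assoc matrix_vector_mult_0_right)
    then show ?thesis using M unfolding sym_pd_def by (metis inner_zero_right less_irrefl)
  qed
  then have "\<exists>B. B ** ?S = mat 1" using matrix_left_invertible_ker by blast
  then have "\<exists>B. ?S ** B = mat 1 \<and> B ** ?S = mat 1" using matrix_left_right_inverse by blast
  from someI_ex[OF this] show "inv_sqrt M ** ?S = mat 1" "?S ** inv_sqrt M = mat 1"
    by (simp_all add: inv_sqrt_def matrix_inv_def)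
qed

lemma inv_sqrt_symmetric:
  assumes M: "sym_pd M"
  shows "transpose (inv_sqrt M) = inv_sqrt M"
proof -
  let ?S = "psd_sqrt M" and ?R = "inv_sqrt M"
  have "transpose ?S = ?S" using psd_sqrt[OF sym_pd_imp_psd[OF M]] by (simp add: sym_psd_def)
  then have "transpose ?R ** ?S = mat 1"
    using inv_sqrt_psd_sqrt(2)[OF M] by (metis matrix_transpose_mul transpose_mat)
  then show ?thesis
    using inv_sqrt_psd_sqrt(2)[OF M] by (metis matrix_mul_assoc matrix_mul_lid matrix_mul_rid)
qed

section \<open>The second smallest eigenvalue\<close>

text \<open>Lift the matrix \<open>W\<close> of eigenvectors to constant polynomials. Then \<open>(X I - A) W = W E\<close> with \<open>E\<close>
  diagonal, and \<open>det W\<close> is invertible because \<open>W\<close> is orthogonal.\<close>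

lemma charpoly_eigenbasis:
  fixes A :: "real^'n^'n" and w :: "'n \<Rightarrow> real^'n"
  assumes w: "orthonormal_family w" and eig: "\<And>k. A *v w k = d k *\<^sub>R w k"
  shows "charpoly A = (\<Prod>k\<in>UNIV. [:- d k, 1:])"
proof -
  define X :: "real poly^'n^'n"
    where "X = (\<chi> i j. (if i = j then [:0, 1:] else 0) - [:A $ i $ j:])"
  define W W' :: "real poly^'n^'n"
    where "W = (\<chi> i k. [:w k $ i:])" and "W' = (\<chi> k i. [:w k $ i:])"
  define E :: "real poly^'n^'n" where "E = (\<chi> k l. if k = l then [:- d k, 1:] else 0)"
  have const_sum: "(\<Sum>j\<in>UNIV. [:f j:]) = [:\<Sum>j\<in>UNIV. f j:]" for f :: "'n \<Rightarrow> real"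
    using finite_class.finite_UNIV by (induction rule: finite_induct) auto
  have eig': "(\<Sum>j\<in>UNIV. A $ i $ j * w k $ j) = d k * w k $ i" for i k
    using arg_cong[OF eig[of k], of "\<lambda>x. x $ i"] by (simp add: matrix_vector_mult_def)
  have "(X ** W) $ i $ k = (W ** E) $ i $ k" for i k
  proof -
    have "(X ** W) $ i $ k = (\<Sum>j\<in>UNIV. (if i = j then [:0, 1:] * [:w k $ j:] else 0))
        - (\<Sum>j\<in>UNIV. [:A $ i $ j * w k $ j:])"
      unfolding sum_subtractf[symmetric]
      by (auto simp: X_def W_def matrix_matrix_mult_def left_diff_distrib intro!: sum.cong)
    also have "\<dots> = [:0, 1:] * [:w k $ i:] - [:d k * w k $ i:]"
      by (simp add: const_sum eig')
    also have "\<dots> = [:w k $ i:] * [:- d k, 1:]" by simp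
    also have "\<dots> = (\<Sum>l\<in>UNIV. if l = k then [:w k $ i:] * [:- d k, 1:] else 0)" by simp
    also have "\<dots> = (W ** E) $ i $ k"
      by (simp only: W_def E_def matrix_matrix_mult_def vec_lambda_beta) (rule sum.cong; simp)
    finally show ?thesis .
  qed
  then have XW: "X ** W = W ** E" by (simp add: vec_eq_iff)
  have "(W' ** W) $ k $ l = (mat 1 :: real poly^'n^'n) $ k $ l" for k l
  proof -
    have "(W' ** W) $ k $ l = [:w k \<bullet> w l:]"
      by (simp add: W_def W'_def matrix_matrix_mult_def inner_vec_def const_sum mult.commute)
    then show ?thesis by (simp add: orthonormal_family_inner[OF w] mat_def one_pCons)
  qed
  then have "W' ** W = mat 1" by (simp add: vec_eq_iff)
  then have "det W' * det W = 1" by (metis det_I det_mul)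
  then have "det W \<noteq> 0" by auto
  moreover have "det X * det W = det W * det E" using XW by (metis det_mul)
  ultimately have "det X = det E" by simp
  also have "det E = (\<Prod>k\<in>UNIV. [:- d k, 1:])"
    by (subst det_diagonal) (auto simp: E_def)
  finally show ?thesis by (simp add: charpoly_def X_def)
qed

lemma eigenvalue_list_eigenbasis:
  fixes A :: "real^'n^'n" and w :: "'n \<Rightarrow> real^'n"
  assumes "orthonormal_family w" and "\<And>k. A *v w k = d k *\<^sub>R w k"
  shows "mset (eigenvalue_list A) = image_mset d (mset_set UNIV)"
proof -
  have "proots (charpoly A) = (\<Sum>k\<in>UNIV. {#d k#})"
    unfolding charpoly_eigenbasis[OF assms] by (subst proots_prod) auto
  also have "\<dots> = image_mset d (mset_set UNIV)"
    using finite_class.finite_UNIV by (induction rule: finite_induct) auto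
  finally show ?thesis by (simp add: eigenvalue_list_def)
qed

text \<open>This reads off the sign of the second eigenvalue from the multiset of eigenvalues.\<close>

lemma sorted_second_pos_iff:
  fixes L :: "real list"
  assumes "sorted L" "length L \<ge> 2"
  shows "L ! 1 > 0 \<longleftrightarrow> size (filter_mset (\<lambda>x. x \<le> 0) (mset L)) \<le> 1"
proof -
  obtain a b L' where L: "L = a # b # L'"
    using assms(2) by (metis Suc_le_length_iff numeral_2_eq_2)
  show ?thesis
  proof (cases "b > 0")
    case True
    then have none: "filter_mset (\<lambda>x. x \<le> 0) (mset L') = {#}"
      using assms(1) by (subst mset_filter[symmetric]) (force simp: L filter_empty_conv)
    show ?thesis using True by (simp add: L none)
  next
    case False
    then show ?thesis using assms(1) by (simp add: L)
  qed
qed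

lemma lambda2_pos_iff_card:
  fixes A :: "real^'n^'n" and w :: "'n \<Rightarrow> real^'n"
  assumes "CARD('n) \<ge> 2" "orthonormal_family w" "\<And>k. A *v w k = d k *\<^sub>R w k"
  shows "lambda2 A > 0 \<longleftrightarrow> card {k. d k \<le> 0} \<le> 1"
proof -
  note ms = eigenvalue_list_eigenbasis[OF assms(2,3)]
  have "length (eigenvalue_list A) = CARD('n)"
    using arg_cong[OF ms, of size] by simp
  moreover have "sorted (eigenvalue_list A)" by (simp add: eigenvalue_list_def)
  ultimately show ?thesis
    using sorted_second_pos_iff[of "eigenvalue_list A"] assms(1)
    by (simp add: lambda2_def ms filter_mset_image_mset)
qed

text \<open>The null vectors of the form of a positive semidefinite matrix are the combinations of its
  eigenvectors with eigenvalue zero. So there is at most one such eigenvector iff any null vector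
  is a multiple of any nonzero null vector.\<close>

lemma lambda2_pos_iff:
  fixes A :: "real^'n^'n"
  assumes card: "CARD('n) \<ge> 2" and A: "sym_psd A"
  shows "lambda2 A > 0 \<longleftrightarrow>
    (\<forall>x y. x \<bullet> (A *v x) = 0 \<and> y \<bullet> (A *v y) = 0 \<and> y \<noteq> 0 \<longrightarrow> (\<exists>c. x = c *\<^sub>R y))"
proof -
  obtain w :: "'n \<Rightarrow> real^'n" and d where w: "orthonormal_family w"
    and eig: "\<And>k. A *v w k = d k *\<^sub>R w k"
    using symmetric_matrix_eigenbasis A unfolding sym_psd_def by metis
  have d: "d k \<ge> 0" for k using psd_eigenvalue_nonneg[OF A w eig] .
  note lambda2_iff = lambda2_pos_iff_card[OF card w eig]
  have quad: "x \<bullet> (A *v x) = (\<Sum>k\<in>UNIV. d k * (w k \<bullet> x)\<^sup>2)" for x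
  proof -
    have "x \<bullet> (A *v x) = x \<bullet> (A *v (\<Sum>k\<in>UNIV. (w k \<bullet> x) *\<^sub>R w k))"
      by (simp add: orthonormal_family_expand[OF w])
    also have "\<dots> = (\<Sum>k\<in>UNIV. d k * (w k \<bullet> x)\<^sup>2)"
      by (simp add: linear_sum[OF matrix_vector_mul_linear] matrix_vector_mult_scaleR eig
          inner_sum_right inner_commute power2_eq_square mult_ac)
    finally show ?thesis .
  qed
  show ?thesis
  proof
    assume "lambda2 A > 0"
    then have "card {k. d k \<le> 0} \<le> 1" using lambda2_iff by simp
    then have unique: "\<forall>i j. d i \<le> 0 \<longrightarrow> d j \<le> 0 \<longrightarrow> i = j"
      using card_le_Suc0_iff_eq[of "{k. d k \<le> 0}"] by simp
    obtain l where l: "\<And>k. d k \<le> 0 \<Longrightarrow> k = l" using unique by metis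
    have null: "x = (w l \<bullet> x) *\<^sub>R w l" if "x \<bullet> (A *v x) = 0" for x
    proof -
      have "\<forall>k\<in>UNIV. d k * (w k \<bullet> x)\<^sup>2 = 0"
        using that d unfolding quad by (subst sum_nonneg_eq_0_iff[symmetric]) auto
      then have "w k \<bullet> x = 0" if "k \<noteq> l" for k using l[of k] that by force
      then have "(\<Sum>k\<in>UNIV. (w k \<bullet> x) *\<^sub>R w k) = (\<Sum>k\<in>UNIV. if k = l then (w l \<bullet> x) *\<^sub>R w l else 0)"
        by (intro sum.cong) auto
      then show ?thesis by (simp add: orthonormal_family_expand[OF w])
    qed
    show "\<forall>x y. x \<bullet> (A *v x) = 0 \<and> y \<bullet> (A *v y) = 0 \<and> y \<noteq> 0 \<longrightarrow> (\<exists>c. x = c *\<^sub>R y)"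
    proof (intro allI impI, elim conjE)
      fix x y assume x: "x \<bullet> (A *v x) = 0" and y: "y \<bullet> (A *v y) = 0" "y \<noteq> 0"
      have "w l \<bullet> y \<noteq> 0" using null[OF y(1)] y(2) by force
      then have "w l = (1 / (w l \<bullet> y)) *\<^sub>R y" by (subst (2) null[OF y(1)]) simp
      then show "\<exists>c. x = c *\<^sub>R y" using null[OF x] by (metis scaleR_scaleR)
    qed
  next
    assume R: "\<forall>x y. x \<bullet> (A *v x) = 0 \<and> y \<bullet> (A *v y) = 0 \<and> y \<noteq> 0 \<longrightarrow> (\<exists>c. x = c *\<^sub>R y)"
    have "i = j" if "d i \<le> 0" "d j \<le> 0" for i j
    proof (rule ccontr)
      assume "i \<noteq> j"
      have "d i = 0" "d j = 0" using that d[of i] d[of j] by auto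
      then have "w i \<bullet> (A *v w i) = 0" "w j \<bullet> (A *v w j) = 0" by (simp_all add: eig)
      moreover have "w j \<noteq> 0" using orthonormal_family_inner[OF w, of j j] by auto
      ultimately obtain c where "w i = c *\<^sub>R w j" using R by blast
      then have "w i \<bullet> w i = c * (w i \<bullet> w j)" by (metis inner_scaleR_right)
      then show False using \<open>i \<noteq> j\<close> by (simp add: orthonormal_family_inner[OF w])
    qed
    then have "card {k. d k \<le> 0} \<le> 1"
      using card_le_Suc0_iff_eq[of "{k. d k \<le> 0}"] by auto
    then show "lambda2 A > 0" using lambda2_iff by simp
  qed
qed

section \<open>Weighted graph Laplacians\<close>

text \<open>Summation by parts: exchanging the two indices and averaging. It serves twice, for scalar
  Laplacians and for the vector-valued coupling of the array.\<close>

lemma sum_antisymmetric_inner: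
  fixes x :: "'q::finite \<Rightarrow> 'a::real_inner"
  assumes "\<And>i j. c j i = - c i j"
  shows "(\<Sum>i\<in>UNIV. \<Sum>j\<in>UNIV. x i \<bullet> c i j) = (\<Sum>i\<in>UNIV. \<Sum>j\<in>UNIV. (x i - x j) \<bullet> c i j) / 2"
proof -
  have "(\<Sum>i\<in>UNIV. \<Sum>j\<in>UNIV. x j \<bullet> c i j) = (\<Sum>i\<in>UNIV. \<Sum>j\<in>UNIV. x i \<bullet> c j i)"
    by (rule sum.swap)
  also have "\<dots> = - (\<Sum>i\<in>UNIV. \<Sum>j\<in>UNIV. x i \<bullet> c i j)"
    by (subst assms) (simp add: sum_negf)
  finally show ?thesis by (simp add: inner_diff_left sum_subtractf)
qed

definition laplacian :: "('q::finite \<Rightarrow> 'q \<Rightarrow> real) \<Rightarrow> real^'q^'q" where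
  "laplacian g = (\<chi> i j. (if i = j then \<Sum>m\<in>UNIV. g i m else 0) - g i j)"

lemma laplacian_form:
  assumes sym: "\<And>i j. g i j = g j i"
  shows "x \<bullet> (laplacian g *v x) = (\<Sum>i\<in>UNIV. \<Sum>j\<in>UNIV. g i j * (x $ i - x $ j)\<^sup>2) / 2"
proof -
  have anti: "g j i * (x $ j - x $ i) = - (g i j * (x $ i - x $ j))" for i j
    unfolding sym[of j i] by (simp add: algebra_simps)
  have "(laplacian g *v x) $ i = (\<Sum>j\<in>UNIV. g i j * (x $ i - x $ j))" for i
  proof -
    have "(laplacian g *v x) $ i
        = (\<Sum>j\<in>UNIV. (if i = j then (\<Sum>m\<in>UNIV. g i m) * x $ i else 0) - g i j * x $ j)"
      unfolding laplacian_def matrix_vector_mult_def vec_lambda_beta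
      by (intro sum.cong) (auto simp: left_diff_distrib)
    also have "\<dots> = (\<Sum>j\<in>UNIV. g i j * (x $ i - x $ j))"
      by (simp add: sum_subtractf sum_distrib_right right_diff_distrib)
    finally show ?thesis .
  qed
  then have "x \<bullet> (laplacian g *v x) = (\<Sum>i\<in>UNIV. \<Sum>j\<in>UNIV. x $ i \<bullet> (g i j * (x $ i - x $ j)))"
    by (simp add: inner_vec_def sum_distrib_left)
  also have "\<dots> = (\<Sum>i\<in>UNIV. \<Sum>j\<in>UNIV. (x $ i - x $ j) \<bullet> (g i j * (x $ i - x $ j))) / 2"
    by (rule sum_antisymmetric_inner[OF anti])
  finally show ?thesis by (simp add: power2_eq_square mult_ac)
qed

text \<open>The right-hand side is connectedness of the graph with the edges where \<open>g\<close> is positive: a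
  function that is constant along edges is constant. It holds iff the kernel of the Laplacian, which
  always contains the constants, is one-dimensional.\<close>

lemma laplacian_lambda2_pos_iff:
  fixes g :: "'q::finite \<Rightarrow> 'q \<Rightarrow> real"
  assumes card: "CARD('q) \<ge> 2" and sym: "\<And>i j. g i j = g j i" and nonneg: "\<And>i j. g i j \<ge> 0"
  shows "lambda2 (laplacian g) > 0 \<longleftrightarrow>
    (\<forall>f. (\<forall>i j. g i j * (f i - f j) = 0) \<longrightarrow> (\<forall>i j. f i = f j))"
proof -
  have psd: "sym_psd (laplacian g)"
    unfolding sym_psd_def laplacian_form[OF sym]
    using nonneg sym by (auto simp: vec_eq_iff transpose_def laplacian_def intro!: sum_nonneg)
  have null: "x \<bullet> (laplacian g *v x) = 0 \<longleftrightarrow> (\<forall>i j. g i j * (x $ i - x $ j) = 0)" for x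
    unfolding laplacian_form[OF sym]
    by (simp add: sum_nonneg_eq_0_iff sum_nonneg nonneg)
  show ?thesis unfolding lambda2_pos_iff[OF card psd] null
  proof (intro iffI allI impI)
    fix f :: "'q \<Rightarrow> real" and i j
    assume R: "\<forall>x y. (\<forall>i j. g i j * (x $ i - x $ j) = 0) \<and> (\<forall>i j. g i j * (y $ i - y $ j) = 0)
        \<and> y \<noteq> 0 \<longrightarrow> (\<exists>c. x = c *\<^sub>R y)" and f: "\<forall>i j. g i j * (f i - f j) = 0"
    have "(1 :: real^'q) \<noteq> 0" by simp
    then obtain c where "(\<chi> i. f i) = c *\<^sub>R (1 :: real^'q)"
      using R[rule_format, of "\<chi> i. f i" 1] f by auto
    then have "f i = c" for i by (simp add: vec_eq_iff)
    then show "f i = f j" by simp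
  next
    fix x y :: "real^'q"
    assume R: "\<forall>f. (\<forall>i j. g i j * (f i - f j) = 0) \<longrightarrow> (\<forall>i j. f i = f j)"
      and xy: "(\<forall>i j. g i j * (x $ i - x $ j) = 0) \<and> (\<forall>i j. g i j * (y $ i - y $ j) = 0) \<and> y \<noteq> 0"
    have x: "x $ i = x $ j" and y: "y $ i = y $ j" for i j
      using R[rule_format, of "($) x"] R[rule_format, of "($) y"] xy by blast+
    obtain l where "y $ l \<noteq> 0" using xy by (auto simp: vec_eq_iff)
    then have "x $ i = (x $ l / y $ l) * y $ i" for i
      using x[of i l] y[of i l] by simp
    then have "x = (x $ l / y $ l) *\<^sub>R y"
      unfolding vec_eq_iff vector_scaleR_component real_scaleR_def by blast
    then show "\<exists>c. x = c *\<^sub>R y" by blast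
  qed
qed

section \<open>The matrices \<open>G\<^sub>k\<^sub>k\<close> as Laplacians\<close>

lemma sum_UNIV_prod:
  fixes f :: "'a::finite \<times> 'b::finite \<Rightarrow> 'c::comm_monoid_add"
  shows "(\<Sum>p\<in>UNIV. f p) = (\<Sum>a\<in>UNIV. \<Sum>b\<in>UNIV. f (a, b))"
  by (simp add: sum.cartesian_product UNIV_Times_UNIV[symmetric] del: UNIV_Times_UNIV)

lemma bilinear_form_sum: "x \<bullet> (A *v y) = (\<Sum>a\<in>UNIV. \<Sum>b\<in>UNIV. x $ a * A $ a $ b * y $ b)"
  by (simp add: inner_vec_def matrix_vector_mult_def sum_distrib_left mult.assoc)

lemma matrix_vector_mult_sum_left: "(\<Sum>i\<in>I. A i) *v x = (\<Sum>i\<in>I. A i *v x)"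
  by (induction I rule: infinite_finite_induct) (simp_all add: matrix_vector_mult_add_rdistrib)

text \<open>Multiplication by the Kronecker products picks out the forms \<open>v \<bullet> B v\<close> of the blocks \<open>B\<close> of
  \<open>L_d\<close>. As \<open>D i i = 0\<close>, the weights \<open>g i i\<close> vanish and the
  diagonal of the Laplacian consists of plain row sums.\<close>

lemma G_mat_eq_laplacian:
  assumes diag: "\<And>i. D i i = 0"
  shows "G_mat M D v = laplacian (\<lambda>i j. v \<bullet> ((inv_sqrt M ** D i j ** inv_sqrt M) *v v))"
    (is "_ = laplacian ?g")
proof -
  let ?E = "\<lambda>i j. inv_sqrt M ** D i j ** inv_sqrt M"
  have E0: "?E i i = 0" for i by (simp add: diag matrix_matrix_mult_def vec_eq_iff)
  have "G_mat M D v $ i $ j = laplacian ?g $ i $ j" for i j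
  proof -
    define B where "B = (if i = j then \<Sum>m\<in>UNIV. ?E i m else - ?E i j)"
    have "G_mat M D v $ i $ j = (\<Sum>b\<in>UNIV. (\<Sum>a\<in>UNIV. v $ a * L_d M D $ (i, a) $ (j, b)) * v $ b)"
    proof -
      have "G_mat M D v $ i $ j = (\<Sum>l\<in>UNIV. \<Sum>b\<in>UNIV. (\<Sum>m\<in>UNIV. \<Sum>a\<in>UNIV.
          (if i = m then v $ a * L_d M D $ (m, a) $ (l, b) else 0)) * (if l = j then v $ b else 0))"
        unfolding G_mat_def Let_def vec_lambda_beta matrix_matrix_mult_def kronecker_def
          sum_UNIV_prod mat_def rowvector_def columnvector_def
        by (intro sum.cong arg_cong2[of _ _ _ _ "(*)"]) auto
      also have "\<dots> = (\<Sum>l\<in>UNIV. if l = j then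
          (\<Sum>b\<in>UNIV. (\<Sum>a\<in>UNIV. v $ a * L_d M D $ (i, a) $ (l, b)) * v $ b) else 0)"
      proof (intro sum.cong refl)
        fix l
        have "(\<Sum>m\<in>UNIV. \<Sum>a\<in>UNIV. (if i = m then v $ a * L_d M D $ (m, a) $ (l, b) else 0))
          = (\<Sum>m\<in>UNIV. if i = m then (\<Sum>a\<in>UNIV. v $ a * L_d M D $ (m, a) $ (l, b)) else 0)" for b
          by (intro sum.cong) auto
        then show "(\<Sum>b\<in>UNIV. (\<Sum>m\<in>UNIV. \<Sum>a\<in>UNIV.
          (if i = m then v $ a * L_d M D $ (m, a) $ (l, b) else 0)) * (if l = j then v $ b else 0))
          = (if l = j then
          (\<Sum>b\<in>UNIV. (\<Sum>a\<in>UNIV. v $ a * L_d M D $ (i, a) $ (l, b)) * v $ b) else 0)"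
          by simp
      qed
      finally show ?thesis by simp
    qed
    also have "\<dots> = (\<Sum>b\<in>UNIV. \<Sum>a\<in>UNIV. v $ a * B $ a $ b * v $ b)"
      by (simp add: L_d_def B_def sum_distrib_right)
    also have "\<dots> = v \<bullet> (B *v v)"
      unfolding bilinear_form_sum by (rule sum.swap)
    also have "\<dots> = laplacian ?g $ i $ j"
    proof (cases "i = j")
      case True
      have "(\<Sum>m\<in>UNIV. ?E i m) *v v = (\<Sum>m\<in>UNIV. ?E i m *v v)"
        by (rule matrix_vector_mult_sum_left)
      then show ?thesis using True E0 by (simp add: B_def laplacian_def inner_sum_right)
    next
      case False
      have "(- ?E i j) *v v = - (?E i j *v v)"
        by (simp add: vec_eq_iff matrix_vector_mult_def sum_negf)
      then show ?thesis using False by (simp add: B_def laplacian_def)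
    qed
    finally show ?thesis .
  qed
  then show ?thesis by (simp add: vec_eq_iff)
qed

section \<open>Decay along bounded linear flows\<close>

text \<open>By Taylor's formula \<open>h f'(t)\<close> differs from \<open>f(t + h) - f t\<close> by at most \<open>B h\<^sup>2\<close>. For fixed small \<open>h\<close>
  the difference tends to zero, so \<open>|f'(t)|\<close> is eventually at most about \<open>B h\<close>.\<close>

lemma derivative_tendsto_0:
  fixes f :: "real \<Rightarrow> 'a::real_normed_vector"
  assumes f': "\<And>t. t \<ge> 0 \<Longrightarrow> (f has_vector_derivative f' t) (at t within {0..})"
    and f'': "\<And>t. t \<ge> 0 \<Longrightarrow> (f' has_vector_derivative f'' t) (at t within {0..})"
    and B: "\<And>t. t \<ge> 0 \<Longrightarrow> norm (f'' t) \<le> B"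
    and lim: "(f \<longlongrightarrow> l) at_top"
  shows "(f' \<longlongrightarrow> 0) at_top"
proof (rule tendstoI)
  fix e :: real assume "e > 0"
  have "B \<ge> 0" using order_trans[OF norm_ge_zero B[of 0]] by simp
  \<comment> \<open>Small enough that the Taylor error contributes less than \<open>e / 2\<close>; the \<open>+ 1\<close> covers \<open>B = 0\<close>.\<close>
  define h where "h = e / (2 * (B + 1))"
  have "h > 0" using \<open>e > 0\<close> \<open>B \<ge> 0\<close> by (simp add: h_def)
  have "(B + 1) * h = e / 2" using \<open>B \<ge> 0\<close> by (simp add: h_def divide_simps)
  then have Bh: "B * h < e / 2" using \<open>h > 0\<close> by (simp add: algebra_simps)
  have step: "norm (f (t + h) - f t - h *\<^sub>R f' t) \<le> h * (B * h)" if "t \<ge> 0" for t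
  proof -
    have sub: "{t..t+h} \<subseteq> {0..}" using that by auto
    have lip: "norm (f' x - f' t) \<le> B * h" if x: "x \<in> {t..t+h}" for x
    proof -
      have "norm (f' x - f' t) \<le> B * norm (x - t)"
      proof (rule differentiable_bound[where S="{t..t+h}" and f'="\<lambda>x d. d *\<^sub>R f'' x"])
        fix s assume s: "s \<in> {t..t+h}"
        show "(f' has_derivative (\<lambda>d. d *\<^sub>R f'' s)) (at s within {t..t+h})"
          using has_vector_derivative_within_subset[OF f'' sub] s that sub
          by (simp add: has_vector_derivative_def)
        show "onorm (\<lambda>d. d *\<^sub>R f'' s) \<le> B"
          using B[of s] s sub by (intro onorm_le) (auto simp: mult.commute[of B] mult_left_mono)
      qed (use x \<open>h > 0\<close> in auto)
      also have "\<dots> \<le> B * h" using x \<open>B \<ge> 0\<close> by (intro mult_left_mono) auto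
      finally show ?thesis .
    qed
    have "norm (f (t + h) - f t - (t + h - t) *\<^sub>R f' t) \<le> norm (t + h - t) * (B * h)"
    proof (rule vector_differentiable_bound_linearization[where S="{t..t+h}"])
      show "(f has_vector_derivative f' x) (at x within {t..t+h})" if "x \<in> {t..t+h}" for x
        using has_vector_derivative_within_subset[OF f' sub] that sub by auto
    qed (use lip \<open>h > 0\<close> in \<open>auto simp: closed_segment_eq_real_ivl\<close>)
    then show ?thesis using \<open>h > 0\<close> by simp
  qed
  have "eventually (\<lambda>s. dist (f s) l < e * h / 4) at_top"
    using tendstoD[OF lim, of "e * h / 4"] \<open>e > 0\<close> \<open>h > 0\<close> by simp
  then obtain T where T: "\<And>s. s \<ge> T \<Longrightarrow> norm (f s - l) < e * h / 4"
    unfolding eventually_at_top_linorder dist_norm by blast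
  have "norm (f' t) < e" if t: "t \<ge> max T 0" for t
  proof -
    have "h * norm (f' t) = norm ((f (t + h) - l) - (f t - l) - (f (t + h) - f t - h *\<^sub>R f' t))"
      using \<open>h > 0\<close> by simp
    also have "\<dots> \<le> norm (f (t + h) - l) + norm (f t - l) + norm (f (t + h) - f t - h *\<^sub>R f' t)"
      by (meson norm_triangle_ineq4 order_trans add_right_mono)
    also have "\<dots> < e * h / 4 + e * h / 4 + h * (B * h)"
      using T[of t] T[of "t + h"] step[of t] t \<open>h > 0\<close> by simp
    also have "\<dots> = h * (e / 2 + B * h)" by (simp add: algebra_simps)
    finally have "norm (f' t) < e / 2 + B * h" using \<open>h > 0\<close> by simp
    then show ?thesis using Bh by simp
  qed
  then show "eventually (\<lambda>t. dist (f' t) 0 < e) at_top"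
    unfolding eventually_at_top_linorder dist_norm diff_zero by blast
qed

text \<open>Along \<open>z' = A z\<close> the output \<open>C z\<close> has derivatives \<open>C A z\<close> and \<open>C A A z\<close>, and the latter is bounded.\<close>

lemma linear_flow_output_tendsto_0:
  fixes A :: "'a::euclidean_space \<Rightarrow> 'a" and C :: "'a \<Rightarrow> 'b::real_normed_vector"
  assumes A: "linear A" and C: "linear C"
    and flow: "\<And>t. t \<ge> 0 \<Longrightarrow> (z has_vector_derivative A (z t)) (at t within {0..})"
    and bdd: "bounded (z ` {0..})"
    and lim: "((\<lambda>t. C (z t)) \<longlongrightarrow> 0) at_top"
  shows "((\<lambda>t. C (A (z t))) \<longlongrightarrow> 0) at_top"
proof -
  have bl: "bounded_linear (\<lambda>x. C (A x))" "bounded_linear C" "bounded_linear (\<lambda>x. C (A (A x)))"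
    using linear_compose[OF A C] linear_compose[OF A linear_compose[OF A C]] C
    by (simp_all add: o_def linear_conv_bounded_linear)
  have "bounded ((\<lambda>x. C (A (A x))) ` z ` {0..})"
    by (rule bounded_linear_image[OF bdd bl(3)])
  then obtain B where B: "\<And>t. t \<ge> 0 \<Longrightarrow> norm (C (A (A (z t)))) \<le> B"
    unfolding bounded_iff by auto
  show ?thesis
    by (rule derivative_tendsto_0[OF bounded_linear.has_vector_derivative[OF bl(2) flow]
          bounded_linear.has_vector_derivative[OF bl(1) flow] B lim])
qed

lemma antimono_bounded_below_convergent:
  fixes f :: "real \<Rightarrow> real"
  assumes mono: "\<And>s t. 0 \<le> s \<Longrightarrow> s \<le> t \<Longrightarrow> f t \<le> f s" and lower: "\<And>t. t \<ge> 0 \<Longrightarrow> b \<le> f t"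
  obtains l where "(f \<longlongrightarrow> l) at_top"
proof -
  define l where "l = (INF t\<in>{0..}. f t)"
  have bdd: "bdd_below (f ` {0..})" using lower by (intro bdd_belowI[of _ b]) auto
  have "(f \<longlongrightarrow> l) at_top"
  proof (rule order_tendstoI)
    fix a assume "a < l"
    have "\<forall>t\<ge>0. a < f t"
      using \<open>a < l\<close> cINF_lower[OF bdd] unfolding l_def by force
    then show "eventually (\<lambda>t. a < f t) at_top" unfolding eventually_at_top_linorder by blast
  next
    fix a assume "l < a"
    then obtain s where s: "s \<ge> 0" "f s < a"
      using cINF_less_iff[of "{0::real..}" f a] bdd unfolding l_def by auto
    then have "\<forall>t\<ge>s. f t < a" using mono by (meson le_less_trans)
    then show "eventually (\<lambda>t. f t < a) at_top" unfolding eventually_at_top_linorder by blast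
  qed
  then show thesis using that by blast
qed

lemma has_vector_derivative_vec_lambda:
  fixes f :: "'q::finite \<Rightarrow> real \<Rightarrow> 'a::euclidean_space"
  assumes "\<And>i. (f i has_vector_derivative f' i) F"
  shows "((\<lambda>t. \<chi> i. f i t) has_vector_derivative (\<chi> i. f' i)) F"
proof -
  define e :: "'q \<Rightarrow> 'a \<Rightarrow> 'a^'q" where "e i x = (\<chi> j. if j = i then x else 0)" for i x
  have "linear (e i)" for i by (intro linearI) (auto simp: e_def vec_eq_iff)
  then have bl: "bounded_linear (e i)" for i by (simp add: linear_conv_bounded_linear)
  have sum_e: "(\<Sum>i\<in>UNIV. e i (g i)) = (\<chi> i. g i)" for g
    by (simp add: e_def vec_eq_iff)
  have "((\<lambda>t. \<Sum>i\<in>UNIV. e i (f i t)) has_vector_derivative (\<Sum>i\<in>UNIV. e i (f' i))) F"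
    by (intro has_vector_derivative_sum bounded_linear.has_vector_derivative[OF bl] assms)
  then show ?thesis by (simp only: sum_e)
qed

section \<open>Damped arrays in modal coordinates\<close>

definition weight_coords :: "('n \<Rightarrow> real) \<Rightarrow> real^'n \<Rightarrow> real^'n" where
  "weight_coords p x = (\<chi> k. p k * x $ k)"

lemma weight_coords_nth [simp]: "weight_coords p x $ k = p k * x $ k"
  by (simp add: weight_coords_def)

lemma linear_weight_coords: "linear (weight_coords p)"
  by (intro linearI) (simp_all add: vec_eq_iff algebra_simps)

definition coupling :: "('q::finite \<Rightarrow> 'q \<Rightarrow> real^'n^'n) \<Rightarrow> real^'n^'q \<Rightarrow> real^'n^'q" where
  "coupling F u = (\<chi> i. \<Sum>j\<in>UNIV. F i j *v (u $ i - u $ j))"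

definition stiffness :: "('n \<Rightarrow> real) \<Rightarrow> real^'n^'q \<Rightarrow> real^'n^'q" where
  "stiffness \<sigma> y = (\<chi> i. weight_coords \<sigma> (y $ i))"

text \<open>The equation \<open>y'' + \<Sigma> y + coupling y' = 0\<close>, with \<open>\<Sigma>\<close> the diagonal stiffness matrix, as a
  first-order system on pairs of positions and velocities. It is kept linear on a Euclidean space so that any linear map of the state can
  serve as an output.\<close>

definition array_field ::
  "('q::finite \<Rightarrow> 'q \<Rightarrow> real^'n^'n) \<Rightarrow> ('n \<Rightarrow> real) \<Rightarrow>
   (real^'n^'q) \<times> (real^'n^'q) \<Rightarrow> (real^'n^'q) \<times> (real^'n^'q)" where
  "array_field F \<sigma> z = (snd z, - stiffness \<sigma> (fst z) - coupling F (snd z))"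

lemma linear_coupling: "linear (coupling F)"
  by (intro linearI)
    (simp_all add: coupling_def vec_eq_iff[of _ "_ :: real^_^_"] matrix_vector_right_distrib
      matrix_vector_mult_diff_distrib sum.distrib sum_subtractf matrix_vector_mult_scaleR
      scaleR_sum_right scaleR_diff_right algebra_simps)

lemma linear_stiffness: "linear (stiffness \<sigma>)"
  by (intro linearI)
    (simp_all add: stiffness_def vec_eq_iff[of _ "_ :: real^_^_"] linear_add[OF linear_weight_coords]
      linear_scale[OF linear_weight_coords])

lemma linear_array_field: "linear (array_field F \<sigma>)"
  by (intro linearI)
    (simp_all add: array_field_def linear_add[OF linear_coupling] linear_add[OF linear_stiffness]
      linear_scale[OF linear_coupling] linear_scale[OF linear_stiffness] algebra_simps)

text \<open>A solution of an array whose mass matrix is the identity and whose stiffness matrix is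
  diagonal, with entries \<open>\<sigma> k\<close>. The definitions below name its positions \<open>y\<close>, velocities \<open>u\<close> and
  accelerations \<open>a\<close>.\<close>

locale damped_array =
  fixes F :: "'q::finite \<Rightarrow> 'q \<Rightarrow> real^'n^'n" and \<sigma> :: "'n \<Rightarrow> real"
    and z :: "real \<Rightarrow> (real^'n^'q) \<times> (real^'n^'q)"
  assumes F_psd: "\<And>i j. sym_psd (F i j)" and F_sym: "\<And>i j. F i j = F j i"
    and \<sigma>_pos: "\<And>k. \<sigma> k > 0"
    and flow: "\<And>t. t \<ge> 0 \<Longrightarrow> (z has_vector_derivative array_field F \<sigma> (z t)) (at t within {0..})"
begin

definition y where "y t = fst (z t)"
definition u where "u t = snd (z t)"
definition a where "a t = - stiffness \<sigma> (y t) - coupling F (u t)"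

lemma field_eq: "array_field F \<sigma> (z t) = (u t, a t)"
  by (simp add: array_field_def y_def u_def a_def)

lemma y_derivative: "t \<ge> 0 \<Longrightarrow> (y has_vector_derivative u t) (at t within {0..})"
  using bounded_linear.has_vector_derivative[OF bounded_linear_fst flow] 
  by (simp add: field_eq y_def[abs_def])

lemma u_derivative: "t \<ge> 0 \<Longrightarrow> (u has_vector_derivative a t) (at t within {0..})"
  using bounded_linear.has_vector_derivative[OF bounded_linear_snd flow] 
  by (simp add: field_eq u_def[abs_def])

definition energy where "energy t = (u t \<bullet> u t + y t \<bullet> stiffness \<sigma> (y t)) / 2"

lemma stiffness_symmetric: "stiffness \<sigma> x \<bullet> w = x \<bullet> stiffness \<sigma> w"
  by (simp add: stiffness_def inner_vec_def mult_ac)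

lemma stiffness_pos: obtains c where "c > 0" "\<And>x :: real^'n^'q. c * (x \<bullet> x) \<le> x \<bullet> stiffness \<sigma> x"
proof -
  define c where "c = Min (range \<sigma>)"
  have "c > 0" by (simp add: c_def \<sigma>_pos)
  moreover have "c * (x \<bullet> x) \<le> x \<bullet> stiffness \<sigma> x" for x :: "real^'n^'q"
  proof -
    have "c * (x \<bullet> x) = (\<Sum>i\<in>UNIV. \<Sum>k\<in>UNIV. c * (x $ i $ k * x $ i $ k))"
      by (simp add: inner_vec_def sum_distrib_left)
    also have "\<dots> \<le> (\<Sum>i\<in>UNIV. \<Sum>k\<in>UNIV. \<sigma> k * (x $ i $ k * x $ i $ k))"
      by (intro sum_mono mult_right_mono) (auto simp: c_def)
    also have "\<dots> = x \<bullet> stiffness \<sigma> x" by (simp add: stiffness_def inner_vec_def mult_ac)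
    finally show ?thesis .
  qed
  ultimately show thesis using that by blast
qed

lemma coupling_form:
  "w \<bullet> coupling F w = (\<Sum>i\<in>UNIV. \<Sum>j\<in>UNIV. (w $ i - w $ j) \<bullet> (F i j *v (w $ i - w $ j))) / 2"
proof -
  have anti: "F j i *v (w $ j - w $ i) = - (F i j *v (w $ i - w $ j))" for i j
    unfolding F_sym[of j i] by (simp add: matrix_vector_mult_diff_distrib)
  show ?thesis
    unfolding inner_vec_def[of w] coupling_def vec_lambda_beta inner_sum_right
    by (rule sum_antisymmetric_inner[OF anti])
qed

lemma coupling_form_summand:
  "(w $ i - w $ j) \<bullet> (F i j *v (w $ i - w $ j)) \<le> 2 * (w \<bullet> coupling F w)"
proof -
  let ?g = "\<lambda>i j. (w $ i - w $ j) \<bullet> (F i j *v (w $ i - w $ j))"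
  have nonneg: "0 \<le> ?g i j" for i j using F_psd by (simp add: sym_psd_def)
  have "?g i j \<le> (\<Sum>j\<in>UNIV. ?g i j)"
    by (rule member_le_sum) (rule nonneg | simp)+
  also have "\<dots> \<le> (\<Sum>i\<in>UNIV. \<Sum>j\<in>UNIV. ?g i j)"
    by (rule member_le_sum[where f="\<lambda>i. \<Sum>j\<in>UNIV. ?g i j"]) (rule sum_nonneg nonneg | simp)+
  finally show ?thesis by (simp add: coupling_form)
qed

lemma coupling_form_nonneg: "0 \<le> w \<bullet> coupling F w"
  unfolding coupling_form using F_psd
  by (intro divide_nonneg_nonneg sum_nonneg) (auto simp: sym_psd_def)

lemma energy_derivative:
  assumes "t \<ge> 0"
  shows "(energy has_vector_derivative - (u t \<bullet> coupling F (u t))) (at t within {0..})"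
proof -
  have s: "((\<lambda>t. stiffness \<sigma> (y t)) has_vector_derivative stiffness \<sigma> (u t)) (at t within {0..})"
    by (rule bounded_linear.has_vector_derivative[OF
          linear_conv_bounded_linear[THEN iffD1, OF linear_stiffness] y_derivative[OF assms]])
  have "((\<lambda>t. (u t \<bullet> u t + y t \<bullet> stiffness \<sigma> (y t)) / 2) has_vector_derivative
      ((u t \<bullet> a t + a t \<bullet> u t) + (y t \<bullet> stiffness \<sigma> (u t) + u t \<bullet> stiffness \<sigma> (y t))) / 2)
      (at t within {0..})"
    by (intro has_vector_derivative_divide has_vector_derivative_add
        bounded_bilinear.has_vector_derivative[OF bounded_bilinear_inner]
        s y_derivative u_derivative assms)
  moreover have "y t \<bullet> stiffness \<sigma> (u t) = u t \<bullet> stiffness \<sigma> (y t)"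
    by (metis stiffness_symmetric inner_commute)
  then have "((u t \<bullet> a t + a t \<bullet> u t) + (y t \<bullet> stiffness \<sigma> (u t) + u t \<bullet> stiffness \<sigma> (y t))) / 2
      = - (u t \<bullet> coupling F (u t))"
    unfolding inner_commute[of "a t" "u t"] by (simp add: a_def inner_diff_right)
  ultimately show ?thesis by (simp add: energy_def[abs_def])
qed

lemma energy_antimono:
  assumes "0 \<le> s" "s \<le> t"
  shows "energy t \<le> energy s"
proof -
  have "\<exists>x\<in>{s..t}. energy t - energy s = (t - s) * (- (u x \<bullet> coupling F (u x)))"
  proof (rule mvt_very_simple[OF assms(2)])
    fix x assume "s \<le> x" "x \<le> t"
    then have "(energy has_vector_derivative - (u x \<bullet> coupling F (u x))) (at x within {s..t})"
      using assms by (intro has_vector_derivative_within_subset[OF energy_derivative]) auto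
    then show "(energy has_derivative (\<lambda>h. h * (- (u x \<bullet> coupling F (u x))))) (at x within {s..t})"
      by (simp add: has_vector_derivative_def)
  qed
  then obtain x where "energy t - energy s = - ((t - s) * (u x \<bullet> coupling F (u x)))" by auto
  moreover have "0 \<le> (t - s) * (u x \<bullet> coupling F (u x))"
    using assms coupling_form_nonneg by simp
  ultimately show ?thesis by simp
qed

text \<open>The energy controls the velocities directly and the positions through the smallest stiffness.\<close>

lemma state_bounded: "bounded (z ` {0..})"
proof -
  obtain c where c: "c > 0" "\<And>x :: real^'n^'q. c * (x \<bullet> x) \<le> x \<bullet> stiffness \<sigma> x"
    using stiffness_pos by blast
  have "norm (u t) \<le> sqrt (2 * energy 0)" "norm (y t) \<le> sqrt (2 * energy 0 / c)" if "t \<ge> 0" for t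
  proof -
    have "u t \<bullet> u t + c * (y t \<bullet> y t) \<le> 2 * energy 0"
      using energy_antimono[of 0 t] that c(2)[of "y t"] by (simp add: energy_def)
    moreover have "0 \<le> u t \<bullet> u t" "0 \<le> c * (y t \<bullet> y t)" using c(1) by simp_all
    ultimately have 1: "u t \<bullet> u t \<le> 2 * energy 0" and 2: "c * (y t \<bullet> y t) \<le> 2 * energy 0"
      by linarith+
    show "norm (u t) \<le> sqrt (2 * energy 0)" using 1 by (simp add: norm_eq_sqrt_inner)
    show "norm (y t) \<le> sqrt (2 * energy 0 / c)"
      using 2 c(1) by (simp add: norm_eq_sqrt_inner pos_le_divide_eq mult.commute)
  qed
  then have "norm (z t) \<le> sqrt (2 * energy 0 / c) + sqrt (2 * energy 0)" if "t \<ge> 0" for t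
    using norm_Pair_le[of "y t" "u t"] that by (simp add: y_def u_def) (meson add_mono order_trans)
  then show ?thesis unfolding bounded_iff by auto
qed

lemma output_tendsto_0:
  fixes C :: "_ \<Rightarrow> 'b::real_normed_vector"
  assumes "linear C" "((\<lambda>t. C (z t)) \<longlongrightarrow> 0) at_top"
  shows "((\<lambda>t. C (array_field F \<sigma> (z t))) \<longlongrightarrow> 0) at_top"
  by (rule linear_flow_output_tendsto_0[OF linear_array_field assms(1) flow state_bounded assms(2)])

text \<open>The dissipated power is the negative derivative of the energy. The energy converges, being
  nonincreasing and nonnegative, and its second derivative is bounded because the velocities and
  accelerations are.\<close>

lemma dissipation_tendsto_0: "((\<lambda>t. u t \<bullet> coupling F (u t)) \<longlongrightarrow> 0) at_top"
proof -
  have "0 \<le> energy t" for t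
  proof -
    obtain c where c: "c > 0" "\<And>x :: real^'n^'q. c * (x \<bullet> x) \<le> x \<bullet> stiffness \<sigma> x"
      using stiffness_pos by blast
    have "0 \<le> c * (y t \<bullet> y t)" using c(1) by simp
    then show ?thesis using c(2)[of "y t"] unfolding energy_def
      by (smt (verit) inner_ge_zero divide_nonneg_nonneg)
  qed
  then obtain l where l: "(energy \<longlongrightarrow> l) at_top"
    using antimono_bounded_below_convergent energy_antimono by metis
  have bl: "bounded_linear (coupling F)" using linear_coupling linear_conv_bounded_linear by blast
  have "bounded (u ` {0..})"
    using bounded_linear_image[OF state_bounded bounded_linear_snd]
    by (simp add: image_image u_def[abs_def])
  moreover have "bounded (a ` {0..})"
    using bounded_linear_image[OF bounded_linear_image[OF state_bounded
          linear_conv_bounded_linear[THEN iffD1, OF linear_array_field]] bounded_linear_snd, of F \<sigma>]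
    by (simp add: image_image field_eq)
  ultimately obtain bu ba where bu: "\<And>t. t \<ge> 0 \<Longrightarrow> norm (u t) \<le> bu"
    and ba: "\<And>t. t \<ge> 0 \<Longrightarrow> norm (a t) \<le> ba"
    unfolding bounded_iff by auto
  have bu0: "0 \<le> bu" using order_trans[OF norm_ge_zero bu[of 0]] by simp
  have ba0: "0 \<le> ba" using order_trans[OF norm_ge_zero ba[of 0]] by simp
  obtain K where K: "K \<ge> 0" "\<And>x. norm (coupling F x) \<le> norm x * K"
    using bounded_linear.nonneg_bounded[OF bl] by blast
  have cd: "((\<lambda>t. coupling F (u t)) has_vector_derivative coupling F (a t)) (at t within {0..})"
    if "t \<ge> 0" for t
    by (rule bounded_linear.has_vector_derivative[OF bl u_derivative[OF that]])
  have "((\<lambda>t. - (u t \<bullet> coupling F (u t))) \<longlongrightarrow> 0) at_top"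
  proof (rule derivative_tendsto_0[OF energy_derivative _ _ l])
    fix t :: real assume t: "t \<ge> 0"
    show "((\<lambda>t. - (u t \<bullet> coupling F (u t))) has_vector_derivative
        - (u t \<bullet> coupling F (a t) + a t \<bullet> coupling F (u t))) (at t within {0..})"
      by (intro has_vector_derivative_minus
          bounded_bilinear.has_vector_derivative[OF bounded_bilinear_inner] cd u_derivative t)
    have "\<bar>u t \<bullet> coupling F (a t)\<bar> \<le> bu * (ba * K)"
      using Cauchy_Schwarz_ineq2[of "u t" "coupling F (a t)"] 
        mult_mono[OF bu[OF t] order_trans[OF K(2)[of "a t"] mult_right_mono[OF ba[OF t] K(1)]]] bu0
      by simp
    moreover have "\<bar>a t \<bullet> coupling F (u t)\<bar> \<le> ba * (bu * K)"
      using Cauchy_Schwarz_ineq2[of "a t" "coupling F (u t)"] 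
        mult_mono[OF ba[OF t] order_trans[OF K(2)[of "u t"] mult_right_mono[OF bu[OF t] K(1)]]] ba0
      by simp
    ultimately show "norm (- (u t \<bullet> coupling F (a t) + a t \<bullet> coupling F (u t))) 
        \<le> bu * (ba * K) + ba * (bu * K)"
      unfolding norm_minus_cancel real_norm_def by linarith
  qed auto
  then show ?thesis using tendsto_minus by fastforce
qed

lemma coupling_force_tendsto_0: "((\<lambda>t. F i j *v (u t $ i - u t $ j)) \<longlongrightarrow> 0) at_top"
proof -
  let ?d = "\<lambda>t. u t $ i - u t $ j"
  obtain c where c: "\<And>x. (norm (F i j *v x))\<^sup>2 \<le> c * (x \<bullet> (F i j *v x))"
    using sym_psd_norm_le_quadratic[OF F_psd] by blast
  have nn: "0 \<le> ?d t \<bullet> (F i j *v ?d t)" for t using F_psd by (simp add: sym_psd_def)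
  have "((\<lambda>t. ?d t \<bullet> (F i j *v ?d t)) \<longlongrightarrow> 0) at_top"
    by (rule tendsto_sandwich[OF _ _ tendsto_const tendsto_mult_right_zero[OF dissipation_tendsto_0, of 2]])
      (auto simp: nn coupling_form_summand)
  then have cl: "((\<lambda>t. c * (?d t \<bullet> (F i j *v ?d t))) \<longlongrightarrow> 0) at_top"
    by (rule tendsto_mult_right_zero)
  have "((\<lambda>t. (norm (F i j *v ?d t))\<^sup>2) \<longlongrightarrow> 0) at_top"
    by (rule tendsto_sandwich[OF _ _ tendsto_const cl]) (auto simp: c)
  then have "((\<lambda>t. norm (F i j *v ?d t)) \<longlongrightarrow> 0) at_top"
    using tendsto_real_sqrt by fastforce
  then show ?thesis by (rule tendsto_norm_zero_cancel)
qed

text \<open>For the accelerations: \<open>coupling F (a t)\<close> is the derivative of the output \<open>coupling F (u t)\<close>.\<close>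

lemma coupling_tendsto_0:
  "((\<lambda>t. coupling F (u t)) \<longlongrightarrow> 0) at_top" "((\<lambda>t. coupling F (a t)) \<longlongrightarrow> 0) at_top"
proof -
  have "((\<lambda>t. coupling F (u t) $ i) \<longlongrightarrow> 0) at_top" for i
    unfolding coupling_def vec_lambda_beta
    by (rule tendsto_null_sum) (rule coupling_force_tendsto_0)
  then show 1: "((\<lambda>t. coupling F (u t)) \<longlongrightarrow> 0) at_top"
    by - (rule vec_tendstoI, simp only: zero_index)
  have "linear (\<lambda>x. coupling F (snd x))"
    using linear_compose[OF linear_snd linear_coupling] by (simp add: o_def)
  from output_tendsto_0[OF this] 1 show "((\<lambda>t. coupling F (a t)) \<longlongrightarrow> 0) at_top"
    by (simp add: u_def[symmetric] field_eq)
qed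

text \<open>Differentiate the output twice. The equation of motion, differentiated once, says that the second
  derivative of \<open>u\<close> is \<open>- \<Sigma> u - coupling a\<close>, and the coupling term tends to zero.\<close>

lemma weighted_force_step:
  assumes "((\<lambda>t. F i j *v weight_coords p (u t $ i - u t $ j)) \<longlongrightarrow> 0) at_top"
  shows "((\<lambda>t. F i j *v weight_coords (\<lambda>k. \<sigma> k * p k) (u t $ i - u t $ j)) \<longlongrightarrow> 0) at_top"
proof -
  define f where "f x = F i j *v weight_coords p x" for x
  have f: "linear f"
    using linear_compose[OF linear_weight_coords matrix_vector_mul_linear[of "F i j"]]
    by (simp add: f_def[abs_def] o_def)
  define C where "C x = f (snd x $ i - snd x $ j)" for x :: "(real^'n^'q) \<times> (real^'n^'q)"
  have C: "linear C"
    by (intro linearI) (simp_all add: C_def linear_add[OF f] linear_diff[OF f] linear_scale[OF f] algebra_simps)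
  let ?A = "array_field F \<sigma>"
  have "((\<lambda>t. C (?A (z t))) \<longlongrightarrow> 0) at_top"
    using assms by (intro output_tendsto_0 C) (simp add: C_def f_def u_def)
  moreover have "linear (\<lambda>x. C (?A x))"
    using linear_compose[OF linear_array_field C] by (simp add: o_def)
  ultimately have CAA: "((\<lambda>t. C (?A (?A (z t)))) \<longlongrightarrow> 0) at_top"
    using output_tendsto_0[of "\<lambda>x. C (?A x)"] by simp
  let ?r = "\<lambda>t. f (coupling F (a t) $ i - coupling F (a t) $ j)"
  have "((\<lambda>t. coupling F (a t) $ i - coupling F (a t) $ j) \<longlongrightarrow> 0) at_top"
    using tendsto_diff[OF tendsto_vec_nth[OF coupling_tendsto_0(2), of i]
        tendsto_vec_nth[OF coupling_tendsto_0(2), of j]] by simp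
  from bounded_linear.tendsto[OF _ this, of f] f
  have rem: "(?r \<longlongrightarrow> 0) at_top"
    by (simp add: linear_conv_bounded_linear[symmetric] linear_0[OF f])
  have "F i j *v weight_coords (\<lambda>k. \<sigma> k * p k) (u t $ i - u t $ j) = - C (?A (?A (z t))) - ?r t" for t
  proof -
    have "C (?A (?A (z t))) = f (- (weight_coords \<sigma> (u t $ i - u t $ j))
        - (coupling F (a t) $ i - coupling F (a t) $ j))"
      unfolding C_def by (simp add: array_field_def a_def y_def u_def stiffness_def
          linear_diff[OF linear_weight_coords] algebra_simps)
    also have "\<dots> = - f (weight_coords \<sigma> (u t $ i - u t $ j)) - ?r t"
      by (simp add: linear_diff[OF f] linear_neg[OF f])
    also have "f (weight_coords \<sigma> (u t $ i - u t $ j)) =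
        F i j *v weight_coords (\<lambda>k. \<sigma> k * p k) (u t $ i - u t $ j)"
      unfolding f_def by (rule arg_cong[of _ _ "(*v) (F i j)"]) (simp add: vec_eq_iff mult_ac)
    finally show ?thesis by simp
  qed
  then show ?thesis using tendsto_diff[OF tendsto_minus[OF CAA] rem] by simp
qed

text \<open>Each factor \<open>\<sigma> - \<sigma> l\<close> costs one application of the previous lemma.\<close>

lemma polynomial_weighted_force_tendsto_0:
  assumes "finite S"
  shows "((\<lambda>t. F i j *v weight_coords (\<lambda>k. \<Prod>l\<in>S. \<sigma> k - \<sigma> l) (u t $ i - u t $ j)) \<longlongrightarrow> 0) at_top"
  using assms
proof (induction S rule: finite_induct)
  case empty
  have "weight_coords (\<lambda>k. 1) x = x" for x :: "real^'n" by (simp add: vec_eq_iff)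
  then show ?case using coupling_force_tendsto_0 by simp
next
  case (insert l S)
  let ?p = "\<lambda>k. \<Prod>l\<in>S. \<sigma> k - \<sigma> l"
  have "F i j *v weight_coords (\<lambda>k. \<sigma> k * ?p k) x - \<sigma> l *\<^sub>R (F i j *v weight_coords ?p x)
      = F i j *v weight_coords (\<lambda>k. \<Prod>l\<in>insert l S. \<sigma> k - \<sigma> l) x" for x
    unfolding matrix_vector_mult_scaleR[symmetric] matrix_vector_mult_diff_distrib[symmetric]
    using insert.hyps by (intro arg_cong[of _ _ "(*v) (F i j)"]) (simp add: vec_eq_iff algebra_simps)
  moreover have "((\<lambda>t. F i j *v weight_coords (\<lambda>k. \<sigma> k * ?p k) (u t $ i - u t $ j)
      - \<sigma> l *\<^sub>R (F i j *v weight_coords ?p (u t $ i - u t $ j))) \<longlongrightarrow> 0 - \<sigma> l *\<^sub>R 0) at_top"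
    by (intro tendsto_intros weighted_force_step insert.IH)
  ultimately show ?case by simp
qed

text \<open>The product over all \<open>l \<noteq> k\<close> vanishes at every eigenvalue except \<open>\<sigma> k\<close>, so only the \<open>k\<close>-th
  modal velocity remains; read off the \<open>k\<close>-th component of the force.\<close>

lemma modal_force_tendsto_0:
  assumes "inj \<sigma>"
  shows "((\<lambda>t. F i j $ k $ k * (u t $ i $ k - u t $ j $ k)) \<longlongrightarrow> 0) at_top"
proof -
  define p where "p m = (\<Prod>l\<in>UNIV - {k}. \<sigma> m - \<sigma> l)" for m
  have "p k \<noteq> 0" using assms by (auto simp: p_def inj_def)
  have p0: "p m = 0" if "m \<noteq> k" for m using that by (auto simp: p_def)
  have "(F i j *v weight_coords p x) $ k = p k * (F i j $ k $ k * x $ k)" for x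
  proof -
    have "(F i j *v weight_coords p x) $ k = (\<Sum>m\<in>UNIV. if m = k then F i j $ k $ k * (p k * x $ k) else 0)"
      unfolding matrix_vector_mult_def vec_lambda_beta by (intro sum.cong) (auto simp: p0)
    then show ?thesis by simp
  qed
  then have "((\<lambda>t. p k * (F i j $ k $ k * (u t $ i $ k - u t $ j $ k))) \<longlongrightarrow> 0) at_top"
    using tendsto_vec_nth[OF polynomial_weighted_force_tendsto_0[of "UNIV - {k}" i j], of k]
    by (simp add: p_def[symmetric, abs_def])
  then show ?thesis using \<open>p k \<noteq> 0\<close> by (simp add: tendsto_mult_left_iff[where l=0, simplified])
qed

theorem array_synchronizes:
  assumes "inj \<sigma>"
    and conn: "\<And>k (f :: 'q \<Rightarrow> real). (\<And>i j. F i j $ k $ k * (f i - f j) = 0) \<Longrightarrow> (\<forall>i j. f i = f j)"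
  shows "((\<lambda>t. y t $ i - y t $ j) \<longlongrightarrow> 0) at_top"
proof -
  have uk: "((\<lambda>t. u t $ i $ k - u t $ j $ k) \<longlongrightarrow> 0) at_top" for k
  proof -
    \<comment> \<open>The oscillators whose velocities approach that of \<open>i\<close> in mode \<open>k\<close> form a union of components
      of the graph. Connectedness, applied to the indicator function \<open>f\<close> of this set, makes it
      everything.\<close>
    define near where "near m \<longleftrightarrow> ((\<lambda>t. u t $ i $ k - u t $ m $ k) \<longlongrightarrow> 0) at_top" for m
    define f :: "'q \<Rightarrow> real" where "f m = (if near m then 1 else 0)" for m
    have "f l = f m" if "F l m $ k $ k \<noteq> 0" for l m
    proof -
      have lm: "((\<lambda>t. u t $ l $ k - u t $ m $ k) \<longlongrightarrow> 0) at_top"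
        using modal_force_tendsto_0[OF assms(1), of l m k] that
        by (simp add: tendsto_mult_left_iff[where l=0, simplified])
      have "near m" if "near l" using tendsto_add[OF that[unfolded near_def] lm] by (simp add: near_def)
      moreover have "near l" if "near m"
        using tendsto_diff[OF that[unfolded near_def] lm] by (simp add: near_def)
      ultimately show ?thesis by (auto simp: f_def)
    qed
    then have "\<forall>l m. f l = f m" by (intro conn[of k]) auto
    then have "f j = f i" by blast
    moreover have "near i" by (simp add: near_def)
    ultimately have "near j" by (simp add: f_def split: if_splits)
    then show ?thesis by (simp add: near_def)
  qed
  define C where "C x = snd x $ i - snd x $ j" for x :: "(real^'n^'q) \<times> (real^'n^'q)"
  have "linear C" by (intro linearI) (simp_all add: C_def algebra_simps)
  moreover have "((\<lambda>t. C (z t)) \<longlongrightarrow> 0) at_top"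
    using uk by (intro vec_tendstoI) (simp add: C_def u_def)
  ultimately have "((\<lambda>t. C (array_field F \<sigma> (z t))) \<longlongrightarrow> 0) at_top"
    by (rule output_tendsto_0)
  then have acc: "((\<lambda>t. a t $ i - a t $ j) \<longlongrightarrow> 0) at_top" by (simp add: field_eq C_def)
  show ?thesis
  proof (rule vec_tendstoI)
    fix k
    have cpl: "((\<lambda>t. coupling F (u t) $ i $ k - coupling F (u t) $ j $ k) \<longlongrightarrow> 0) at_top"
      using tendsto_diff[OF tendsto_vec_nth[OF tendsto_vec_nth[OF coupling_tendsto_0(1), of i], of k]
          tendsto_vec_nth[OF tendsto_vec_nth[OF coupling_tendsto_0(1), of j], of k]] by simp
    have "\<sigma> k * (y t $ i $ k - y t $ j $ k) =
        - (a t $ i - a t $ j) $ k - (coupling F (u t) $ i $ k - coupling F (u t) $ j $ k)" for t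
      by (simp add: a_def stiffness_def algebra_simps)
    then have "((\<lambda>t. \<sigma> k * (y t $ i $ k - y t $ j $ k)) \<longlongrightarrow> 0) at_top"
      using tendsto_diff[OF tendsto_minus[OF tendsto_vec_nth[OF acc, of k]] cpl] by simp
    then show "((\<lambda>t. (y t $ i - y t $ j) $ k) \<longlongrightarrow> 0 $ k) at_top"
      using \<sigma>_pos[of k] by (simp add: tendsto_mult_left_iff[where l=0, simplified])
  qed
qed

end

section \<open>Normal modes\<close>

text \<open>The expansion property says that the modes \<open>b k\<close> form a basis, whose dual basis is \<open>M b k\<close>.\<close>

locale normal_modes =
  fixes M K :: "real^'n^'n" and \<sigma> :: "'n \<Rightarrow> real" and b :: "'n \<Rightarrow> real^'n"
  assumes mode: "\<And>k. K *v b k = \<sigma> k *\<^sub>R (M *v b k)"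
    and mode_orthonormal: "\<And>k l. b k \<bullet> (M *v b l) = (if k = l then 1 else 0)"
    and mode_expand: "\<And>x. (\<Sum>k\<in>UNIV. (b k \<bullet> (M *v x)) *\<^sub>R b k) = x"
    and M_pd: "sym_pd M" and K_pd: "sym_pd K"
begin

lemma mode_nonzero: "b k \<noteq> 0"
  using mode_orthonormal[of k k] by auto

lemma modal_stiffness_pos: "\<sigma> k > 0"
proof -
  have "0 < b k \<bullet> (K *v b k)" using K_pd mode_nonzero by (simp add: sym_pd_def)
  then show ?thesis by (simp add: mode mode_orthonormal)
qed

definition coords :: "real^'n \<Rightarrow> real^'n" where
  "coords x = (\<chi> k. b k \<bullet> (M *v x))"

definition of_coords :: "real^'n \<Rightarrow> real^'n" where
  "of_coords w = (\<Sum>k\<in>UNIV. w $ k *\<^sub>R b k)"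

text \<open>The matrix of the bilinear form of \<open>A\<close> in the basis of modes (not that of \<open>A\<close> as a linear map).\<close>

definition modal_matrix :: "real^'n^'n \<Rightarrow> real^'n^'n" where
  "modal_matrix A = (\<chi> k l. b k \<bullet> (A *v b l))"

lemma linear_coords: "linear coords"
  by (intro linearI)
    (simp_all add: coords_def vec_eq_iff matrix_vector_right_distrib matrix_vector_mult_scaleR inner_add_right)

lemma linear_of_coords: "linear of_coords"
  by (intro linearI) (simp_all add: of_coords_def scaleR_add_left sum.distrib scaleR_sum_right)

lemma of_coords_coords [simp]: "of_coords (coords x) = x"
  by (simp add: of_coords_def coords_def mode_expand)

lemma modal_matrix_vector: "(modal_matrix A *v w) $ k = b k \<bullet> (A *v of_coords w)"
  by (simp add: modal_matrix_def of_coords_def matrix_vector_mult_def[of "\<chi> k l. b k \<bullet> (A *v b l)"]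
      linear_sum[OF matrix_vector_mul_linear] matrix_vector_mult_scaleR inner_sum_right mult.commute)

lemma modal_matrix_psd:
  assumes A: "sym_psd A"
  shows "sym_psd (modal_matrix A)"
proof -
  have "b l \<bullet> (A *v b k) = b k \<bullet> (A *v b l)" for k l
    using sym_psd_symmetric[OF A, of "b k" "b l"] by (simp add: inner_commute)
  then have "transpose (modal_matrix A) = modal_matrix A"
    by (simp add: modal_matrix_def transpose_def)
  moreover have "w \<bullet> (modal_matrix A *v w) = of_coords w \<bullet> (A *v of_coords w)" for w
    unfolding inner_vec_def[of w] modal_matrix_vector
    by (subst (2) of_coords_def) (simp add: inner_sum_left)
  ultimately show ?thesis using sym_psd_nonneg[OF A] by (simp add: sym_psd_def)
qed

lemma coords_stiffness: "b k \<bullet> (K *v x) = \<sigma> k * coords x $ k"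
proof -
  have "b k \<bullet> (K *v x) = (K *v b k) \<bullet> x"
    using sym_psd_symmetric[OF sym_pd_imp_psd[OF K_pd]] by simp
  also have "\<dots> = \<sigma> k * coords x $ k"
    using sym_psd_symmetric[OF sym_pd_imp_psd[OF M_pd]] by (simp add: mode coords_def)
  finally show ?thesis .
qed

text \<open>Where the amplitudes of two oscillators differ, the damper between them annihilates the mode:
  \<open>b k \<bullet> D i j (b k) = 0\<close> implies \<open>D i j (b k) = 0\<close> by semidefiniteness. So no damper acts, and each
  oscillator moves freely in mode \<open>k\<close>.\<close>

lemma standing_wave_solution:
  assumes D: "\<And>i j. sym_psd (D i j)"
    and f: "\<And>i j. (b k \<bullet> (D i j *v b k)) * (f i - f j) = 0"
  shows "array_solution M K D (\<lambda>i t. (f i * cos (sqrt (\<sigma> k) * t)) *\<^sub>R b k)"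
proof -
  let ?w = "sqrt (\<sigma> k)"
  have w2: "?w * ?w = \<sigma> k" using modal_stiffness_pos[of k] by simp
  define x' where "x' i t = (- f i * ?w * sin (?w * t)) *\<^sub>R b k" for i t
  define x'' where "x'' i t = (- f i * \<sigma> k * cos (?w * t)) *\<^sub>R b k" for i t
  have damping: "D i j *v (x' i t - x' j t) = 0" for i j t
  proof -
    have "D i j *v ((f i - f j) *\<^sub>R b k) = 0"
    proof (cases "f i = f j")
      case False
      then have "b k \<bullet> (D i j *v b k) = 0" using f[of i j] by simp
      moreover obtain c where "\<And>x. (norm (D i j *v x))\<^sup>2 \<le> c * (x \<bullet> (D i j *v x))"
        using sym_psd_norm_le_quadratic[OF D] by blast
      ultimately have "(norm (D i j *v b k))\<^sup>2 \<le> 0" by (metis mult_zero_right)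
      then show ?thesis by (simp add: matrix_vector_mult_scaleR)
    qed simp
    moreover have "x' i t - x' j t = (- ?w * sin (?w * t)) *\<^sub>R ((f i - f j) *\<^sub>R b k)"
      by (simp add: x'_def algebra_simps)
    ultimately show ?thesis by (simp only: matrix_vector_mult_scaleR scaleR_zero_right)
  qed
  show ?thesis
    unfolding array_solution_def
  proof (rule exI[of _ x'], rule exI[of _ x''], intro allI impI conjI)
    fix i and t :: real
    have "((\<lambda>t. f i * cos (?w * t)) has_vector_derivative (- f i * ?w * sin (?w * t))) (at t within {0..})"
      unfolding has_real_derivative_iff_has_vector_derivative[symmetric]
      by (auto intro!: derivative_eq_intros)
    from bounded_linear.has_vector_derivative[OF bounded_linear_scaleR_left this]
    show "((\<lambda>t. (f i * cos (?w * t)) *\<^sub>R b k) has_vector_derivative x' i t) (at t within {0..})"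
      by (simp add: x'_def)
    have "((\<lambda>t. - f i * ?w * sin (?w * t)) has_vector_derivative (- f i * (?w * ?w) * cos (?w * t)))
        (at t within {0..})"
      unfolding has_real_derivative_iff_has_vector_derivative[symmetric]
      by (auto intro!: derivative_eq_intros)
    from bounded_linear.has_vector_derivative[OF bounded_linear_scaleR_left this]
    show "(x' i has_vector_derivative x'' i t) (at t within {0..})"
      unfolding w2 by (simp add: x'_def[abs_def] x''_def)
    show "M *v x'' i t + K *v ((f i * cos (?w * t)) *\<^sub>R b k)
        + (\<Sum>j\<in>UNIV. D i j *v (x' i t - x' j t)) = 0"
      unfolding damping
      by (simp add: x''_def linear_neg[OF matrix_vector_mul_linear] matrix_vector_mult_scaleR mode mult_ac)
  qed
qed

lemma standing_wave_not_decaying: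
  assumes "((\<lambda>t. norm ((c * cos (sqrt (\<sigma> k) * t)) *\<^sub>R b k)) \<longlongrightarrow> 0) at_top"
  shows "c = 0"
proof -
  have w: "sqrt (\<sigma> k) > 0" using modal_stiffness_pos by simp
  let ?s = "\<lambda>m::nat. (2 * pi / sqrt (\<sigma> k)) * real m"
  have "filterlim ?s at_top sequentially"
    using w by (intro filterlim_tendsto_pos_mult_at_top[OF tendsto_const] filterlim_real_sequentially) simp
  from filterlim_compose[OF assms this]
  have "(\<lambda>m. norm ((c * cos (sqrt (\<sigma> k) * ?s m)) *\<^sub>R b k)) \<longlonglongrightarrow> 0" .
  moreover have "cos (sqrt (\<sigma> k) * ?s m) = 1" for m
  proof -
    have "sqrt (\<sigma> k) * ?s m = real m * (2 * pi)" using w by simp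
    then show ?thesis by (metis cos_2npi mult.commute mult.assoc)
  qed
  ultimately have "(\<lambda>m::nat. \<bar>c\<bar> * norm (b k)) \<longlonglongrightarrow> 0" by simp
  then show ?thesis using mode_nonzero[of k] by (simp add: LIMSEQ_const_iff)
qed

lemma modal_solution_damped_array:
  assumes D: "\<And>i j. sym_psd (D i j)" "\<And>i j. D i j = D j i"
    and sol: "\<And>i t. t \<ge> 0 \<Longrightarrow> (x i has_vector_derivative x' i t) (at t within {0..})"
      "\<And>i t. t \<ge> 0 \<Longrightarrow> (x' i has_vector_derivative x'' i t) (at t within {0..})"
      "\<And>i t. t \<ge> 0 \<Longrightarrow> M *v x'' i t + K *v x i t + (\<Sum>j\<in>UNIV. D i j *v (x' i t - x' j t)) = 0"
  shows "damped_array (\<lambda>i j. modal_matrix (D i j)) \<sigma>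
    (\<lambda>t. (\<chi> i. coords (x i t), \<chi> i. coords (x' i t)))"
proof (unfold_locales)
  have blc: "bounded_linear coords" using linear_coords linear_conv_bounded_linear by blast
  fix t :: real assume t: "t \<ge> 0"
  let ?F = "\<lambda>i j. modal_matrix (D i j)"
  let ?y = "\<chi> i. coords (x i t)" and ?u = "\<chi> i. coords (x' i t)"
  have "(\<chi> i. coords (x'' i t)) = - stiffness \<sigma> ?y - coupling ?F ?u"
  proof -
    have "coords (x'' i t) $ k = (- stiffness \<sigma> ?y - coupling ?F ?u) $ i $ k" for i k
    proof -
      have "M *v x'' i t = - (K *v x i t) - (\<Sum>j\<in>UNIV. D i j *v (x' i t - x' j t))"
        using sol(3)[OF t, of i] by (simp add: algebra_simps eq_neg_iff_add_eq_0)
      then have "coords (x'' i t) $ k = - (\<sigma> k * coords (x i t) $ k)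
          - (\<Sum>j\<in>UNIV. b k \<bullet> (D i j *v (x' i t - x' j t)))"
        by (simp add: coords_def[of "x'' i t"] inner_diff_right inner_sum_right coords_stiffness)
      moreover have "b k \<bullet> (D i j *v (x' i t - x' j t)) =
          (modal_matrix (D i j) *v (coords (x' i t) - coords (x' j t))) $ k" for j
        by (simp add: modal_matrix_vector linear_diff[OF linear_of_coords])
      ultimately show ?thesis by (simp add: stiffness_def coupling_def)
    qed
    then show ?thesis by (simp add: vec_eq_iff)
  qed
  then have field: "array_field ?F \<sigma> (?y, ?u) = (?u, \<chi> i. coords (x'' i t))"
    by (simp add: array_field_def)
  show "((\<lambda>t. (\<chi> i. coords (x i t), \<chi> i. coords (x' i t))) has_vector_derivative
      array_field ?F \<sigma> (?y, ?u)) (at t within {0..})"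
    unfolding field
    by (intro has_vector_derivative_Pair has_vector_derivative_vec_lambda
        bounded_linear.has_vector_derivative[OF blc] sol(1,2) t)
qed (use D modal_stiffness_pos modal_matrix_psd in auto)

text \<open>The graph-theoretic form of the criterion, in terms of normal modes of the undamped oscillator
  rather than of the matrix square root.\<close>

theorem synchronizes_iff:
  fixes D :: "'q::finite \<Rightarrow> 'q \<Rightarrow> real^'n^'n"
  assumes D: "\<And>i j. sym_psd (D i j)" "\<And>i j. D i j = D j i" and inj: "inj \<sigma>"
  shows "synchronizes M K D \<longleftrightarrow>
    (\<forall>k f. (\<forall>i j. (b k \<bullet> (D i j *v b k)) * (f i - f j) = 0) \<longrightarrow> (\<forall>i j. f i = f j))"
proof (intro iffI allI impI)
  fix k i j and f :: "'q \<Rightarrow> real"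
  assume sync: "synchronizes M K D" and "\<forall>i j. (b k \<bullet> (D i j *v b k)) * (f i - f j) = 0"
  then have "array_solution M K D (\<lambda>i t. (f i * cos (sqrt (\<sigma> k) * t)) *\<^sub>R b k)"
    by (intro standing_wave_solution D) auto
  then have "((\<lambda>t. norm ((f i * cos (sqrt (\<sigma> k) * t)) *\<^sub>R b k - (f j * cos (sqrt (\<sigma> k) * t)) *\<^sub>R b k))
      \<longlongrightarrow> 0) at_top"
    using sync unfolding synchronizes_def by blast
  then have "f i - f j = 0"
    by (intro standing_wave_not_decaying[of _ k])
      (simp only: scaleR_diff_left[symmetric] left_diff_distrib[symmetric])
  then show "f i = f j" by simp
next
  assume conn: "\<forall>k f. (\<forall>i j. (b k \<bullet> (D i j *v b k)) * (f i - f j) = 0) \<longrightarrow> (\<forall>i j. f i = f j)"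
  show "synchronizes M K D"
    unfolding synchronizes_def
  proof (intro allI impI)
    fix x i j assume "array_solution M K D x"
    then obtain x' x'' where
      sol: "\<And>i t. t \<ge> 0 \<Longrightarrow> (x i has_vector_derivative x' i t) (at t within {0..})"
        "\<And>i t. t \<ge> 0 \<Longrightarrow> (x' i has_vector_derivative x'' i t) (at t within {0..})"
        "\<And>i t. t \<ge> 0 \<Longrightarrow> M *v x'' i t + K *v x i t + (\<Sum>j\<in>UNIV. D i j *v (x' i t - x' j t)) = 0"
      unfolding array_solution_def by blast
    interpret damped_array "\<lambda>i j. modal_matrix (D i j)" \<sigma> "\<lambda>t. (\<chi> i. coords (x i t), \<chi> i. coords (x' i t))"
      by (rule modal_solution_damped_array[OF D sol])
    have conn': "\<forall>i j. f i = f j"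
      if "\<And>i j. modal_matrix (D i j) $ k $ k * (f i - f j) = 0" for k and f :: "'q \<Rightarrow> real"
      using conn[rule_format, of k f] that by (simp add: modal_matrix_def)
    have "((\<lambda>t. y t $ i - y t $ j) \<longlongrightarrow> 0) at_top"
      by (rule array_synchronizes[OF inj]) (rule conn')
    then have "((\<lambda>t. coords (x i t) - coords (x j t)) \<longlongrightarrow> 0) at_top"
      by (simp add: y_def)
    then have "((\<lambda>t. of_coords (coords (x i t) - coords (x j t))) \<longlongrightarrow> of_coords 0) at_top"
      using bounded_linear.tendsto[OF linear_conv_bounded_linear[THEN iffD1, OF linear_of_coords]] by blast
    then have "((\<lambda>t. x i t - x j t) \<longlongrightarrow> 0) at_top"
      by (simp add: linear_diff[OF linear_of_coords] linear_0[OF linear_of_coords])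
    then show "((\<lambda>t. norm (x i t - x j t)) \<longlongrightarrow> 0) at_top" by (rule tendsto_norm_zero)
  qed
qed

end

section \<open>Synchronization\<close>

lemma symmetric_distinct_eigenvalues_orthonormal:
  fixes A :: "real^'n^'n"
  assumes "transpose A = A" "\<And>k. A *v v k = \<sigma> k *\<^sub>R v k" "\<And>k. norm (v k) = 1" "inj \<sigma>"
  shows "orthonormal_family v"
  unfolding orthonormal_family_def
proof (intro allI)
  fix k l
  have "\<sigma> k * (v k \<bullet> v l) = \<sigma> l * (v k \<bullet> v l)"
    using symmetric_matrix_inner[OF assms(1), of "v k" "v l"] by (simp add: assms(2))
  then show "v k \<bullet> v l = (if k = l then 1 else 0)"
    using assms(3)[of k] assms(4) by (auto simp: norm_eq_1 inj_eq)
qed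

text \<open>With \<open>S\<close> the square root of \<open>M\<close> and \<open>R\<close> its inverse, \<open>M R = S\<close>. Hence \<open>K R v = S P v = \<sigma> S v = \<sigma> M R v\<close>
  for an eigenvector \<open>v\<close> of \<open>P\<close>, and \<open>R v \<bullet> M x = v \<bullet> S x\<close>, which carries orthonormality and
  expansions from \<open>v\<close> over to \<open>R v\<close>.\<close>

lemma normal_modes_of_P_mat:
  fixes M K :: "real^'n^'n"
  assumes M: "sym_pd M" and K: "sym_pd K" and eigen: "\<And>k. P_mat M K *v v k = \<sigma> k *\<^sub>R v k"
    and unit: "\<And>k. norm (v k) = 1" and distinct: "inj \<sigma>"
  shows "normal_modes M K \<sigma> (\<lambda>k. inv_sqrt M *v v k)"
proof -
  let ?R = "inv_sqrt M" and ?S = "psd_sqrt M"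
  have R: "(?R *v x) \<bullet> y = x \<bullet> (?R *v y)" for x y
    by (rule symmetric_matrix_inner[OF inv_sqrt_symmetric[OF M]])
  note S = psd_sqrt[OF sym_pd_imp_psd[OF M]]
  have SR: "?S *v (?R *v x) = x" and RS: "?R *v (?S *v x) = x" for x
    by (simp_all add: matrix_vector_mul_assoc inv_sqrt_psd_sqrt[OF M])
  have Mx: "M *v x = ?S *v (?S *v x)" for x by (simp add: matrix_vector_mul_assoc S(2))
  have "transpose (P_mat M K) = P_mat M K"
    using K inv_sqrt_symmetric[OF M]
    by (simp add: P_mat_def matrix_transpose_mul sym_pd_def matrix_mul_assoc)
  then have v: "orthonormal_family v"
    by (rule symmetric_distinct_eigenvalues_orthonormal[OF _ eigen unit distinct])
  have coord: "(?R *v v k) \<bullet> (M *v x) = v k \<bullet> (?S *v x)" for k x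
    unfolding R Mx RS ..
  show ?thesis
  proof
    fix k
    have "?R *v (K *v (?R *v v k)) = \<sigma> k *\<^sub>R v k"
      using eigen[of k] by (simp add: P_mat_def matrix_vector_mul_assoc matrix_mul_assoc)
    then have "?S *v (?R *v (K *v (?R *v v k))) = \<sigma> k *\<^sub>R (?S *v v k)"
      by (simp add: matrix_vector_mult_scaleR)
    then show "K *v (?R *v v k) = \<sigma> k *\<^sub>R (M *v (?R *v v k))" unfolding Mx SR .
  next
    fix k l
    show "(?R *v v k) \<bullet> (M *v (?R *v v l)) = (if k = l then 1 else 0)"
      unfolding coord SR by (rule orthonormal_family_inner[OF v])
  next
    fix x
    have "(\<Sum>k\<in>UNIV. ((?R *v v k) \<bullet> (M *v x)) *\<^sub>R (?R *v v k))
        = ?R *v (\<Sum>k\<in>UNIV. (v k \<bullet> (?S *v x)) *\<^sub>R v k)"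
      unfolding coord by (simp add: linear_sum[OF matrix_vector_mul_linear] matrix_vector_mult_scaleR)
    then show "(\<Sum>k\<in>UNIV. ((?R *v v k) \<bullet> (M *v x)) *\<^sub>R (?R *v v k)) = x"
      by (simp add: orthonormal_family_expand[OF v] RS)
  qed (rule M K)+
qed

theorem theorem3:
  fixes M K :: "real^'n^'n"
    and D :: "'q::finite \<Rightarrow> 'q \<Rightarrow> real^'n^'n"
    and \<sigma> :: "'n \<Rightarrow> real"
    and v :: "'n \<Rightarrow> real^'n"
  assumes q: "CARD('q) \<ge> 2"
    and M: "sym_pd M"
    and K: "sym_pd K"
    and D_psd: "\<And>i j. sym_psd (D i j)"
    and D_sym: "\<And>i j. D i j = D j i"
    and D_diag: "\<And>i. D i i = 0"
    and eigen: "\<And>k. P_mat M K *v v k = \<sigma> k *\<^sub>R v k"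
    and unit: "\<And>k. norm (v k) = 1"
    and distinct: "inj \<sigma>"
  shows "synchronizes M K D \<longleftrightarrow> (\<forall>k. lambda2 (G_mat M D (v k)) > 0)"
proof -
  let ?b = "\<lambda>k. inv_sqrt M *v v k"
  interpret normal_modes M K \<sigma> ?b
    by (rule normal_modes_of_P_mat[OF M K eigen unit distinct])
  have R: "(inv_sqrt M *v x) \<bullet> y = x \<bullet> (inv_sqrt M *v y)" for x y
    by (rule symmetric_matrix_inner[OF inv_sqrt_symmetric[OF M]])
  have G: "G_mat M D (v k) = laplacian (\<lambda>i j. ?b k \<bullet> (D i j *v ?b k))" for k
    unfolding G_mat_eq_laplacian[of D, OF D_diag] R
    by (simp add: matrix_vector_mul_assoc matrix_mul_assoc)
  have "lambda2 (G_mat M D (v k)) > 0 \<longleftrightarrow>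
      (\<forall>f. (\<forall>i j. (?b k \<bullet> (D i j *v ?b k)) * (f i - f j) = 0) \<longrightarrow> (\<forall>i j. f i = f j))" for k
    unfolding G
    by (rule laplacian_lambda2_pos_iff[OF q]) (simp_all add: sym_psd_nonneg[OF D_psd] D_sym)
  then show ?thesis by (simp add: synchronizes_iff[OF D_psd D_sym distinct])
qed

end
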